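(* Let $p,q\ge1$, $\nu>0$, and let $\mathbf{Y}\sim SUT_{p,q}(\boldsymbol{\mu},\boldsymbol{\Sigma},\boldsymbol{\Lambda},\boldsymbol{\tau},\nu,\boldsymbol{\Psi})$. Let $\mathbf{a},\mathbf{b}$ be $p$-dimensional truncation limits with entries in $[-\infty,\infty]$ and $a_i<b_i$ for all $i$, and let $p_1$ be the number of indices $i$ for which $a_i$ and $b_i$ are both finite, $p_2=p-p_1$. Order the coordinates so that $\mathbf{Y}=(\mathbf{Y}_1^\top,\mathbf{Y}_2^\top)^\top$ with $\dim(\mathbf{Y}_1)=p_1$, $\dim(\mathbf{Y}_2)=p_2$, where for each coordinate of $\mathbf{Y}_1$ both truncation limits are finite, and for each coordinate of $\mathbf{Y}_2$ at least one of the two truncation limits is not finite. Partition $\mathbf{a}=(\mathbf{a}_1^\top,\mathbf{a}_2^\top)^\top$, $\mathbf{b}=(\mathbf{b}_1^\top,\mathbf{b}_2^\top)^\top$ and $\mathbf{k}=(\mathbf{k}_1^\top,\mathbf{k}_2^\top)^\top\in\mathbb{N}^p$ accordingly. Then $\mathbb{E}[\mathbf{Y}^{\mathbf{k}}\mid\mathbf{a}\le\mathbf{Y}\le\mathbf{b}]$ exists if and only if $$\mathrm{sum}(\mathbf{k}_2)<\nu+p_1,$$ where $\mathrm{sum}(\mathbf{k}_2)$ is the sum of the entries of $\mathbf{k}_2$.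
   Context: Unified skew-$t$ (SUT) distribution: let $\boldsymbol{\mu}\in\mathbb{R}^p$, $\boldsymbol{\Sigma}\in\mathbb{R}^{p\times p}$ positive definite with symmetric square root $\boldsymbol{\Sigma}^{1/2}$, $\boldsymbol{\Lambda}\in\mathbb{R}^{p\times q}$, $\boldsymbol{\tau}\in\mathbb{R}^q$, $\boldsymbol{\Psi}\in\mathbb{R}^{q\times q}$ a positive-definite correlation matrix, $\nu>0$. Put $$\boldsymbol{\xi}=\begin{pmatrix}\boldsymbol{\tau}\\ \boldsymbol{\mu}\end{pmatrix},\qquad \boldsymbol{\Omega}=\begin{pmatrix}\boldsymbol{\Psi}+\boldsymbol{\Lambda}^\top\boldsymbol{\Lambda}&\boldsymbol{\Omega}_{12}\\ \boldsymbol{\Omega}_{21}&\boldsymbol{\Sigma}\end{pmatrix},\qquad \boldsymbol{\Omega}_{21}=\boldsymbol{\Sigma}^{1/2}\boldsymbol{\Lambda}=\boldsymbol{\Omega}_{12}^\top,$$ and let $\mathbf{X}=(\mathbf{X}_1^\top,\mathbf{X}_2^\top)^\top\sim t_{q+p}(\boldsymbol{\xi},\boldsymbol{\Omega},\nu)$ be multivariate Student-$t$ with location $\boldsymbol{\xi}$, scale matrix $\boldsymbol{\Omega}$ and $\nu$ degrees of freedom, $\mathbf{X}_1\in\mathbb{R}^q$, $\mathbf{X}_2\in\mathbb{R}^p$. Then $SUT_{p,q}(\boldsymbol{\mu},\boldsymbol{\Sigma},\boldsymbol{\Lambda},\boldsymbol{\tau},\nu,\boldsymbol{\Psi})$ is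 the conditional law of $\mathbf{X}_2$ given $\mathbf{X}_1>\mathbf{0}$ (componentwise). $\mathbf{Y}^{\mathbf{k}}$ denotes the product $Y_1^{k_1}\cdots Y_p^{k_p}$, $\mathbb{N}$ includes $0$, and vector inequalities are componentwise. A moment "exists" if the corresponding random variable is (absolutely) integrable under the conditional law. *)

theory Defs
  imports "HOL-Probability.Probability"
begin

definition pos_def :: "real^'n^'n \<Rightarrow> bool" where
  "pos_def A \<longleftrightarrow> transpose A = A \<and> (\<forall>x. x \<noteq> 0 \<longrightarrow> x \<bullet> (A *v x) > 0)"

definition correlation_matrix :: "real^'n^'n \<Rightarrow> bool" where
  "correlation_matrix A \<longleftrightarrow> pos_def A \<and> (\<forall>i. A $ i $ i = 1)"

text \<open>A positive-definite \<open>A\<close> has exactly one positive-definite square root;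
  the value is meaningless for other \<open>A\<close>.\<close>
definition mat_sqrt :: "real^'n^'n \<Rightarrow> real^'n^'n" where
  "mat_sqrt A = (THE B. pos_def B \<and> B ** B = A)"

text \<open>The density with respect to Lebesgue measure, for positive-definite scale matrix
  \<open>\<Omega>\<close> and \<open>\<nu> > 0\<close>.\<close>
definition mvt_density :: "real^'n \<Rightarrow> real^'n^'n \<Rightarrow> real \<Rightarrow> real^'n \<Rightarrow> real" where
  "mvt_density \<xi> \<Omega> \<nu> x =
     Gamma ((\<nu> + real CARD('n)) / 2) /
       (Gamma (\<nu> / 2) * (\<nu> * pi) powr (real CARD('n) / 2) * sqrt (det \<Omega>)) *
     (1 + ((x - \<xi>) \<bullet> (matrix_inv \<Omega> *v (x - \<xi>))) / \<nu>) powr (- (\<nu> + real CARD('n)) / 2)"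

definition mvt :: "real^'n \<Rightarrow> real^'n^'n \<Rightarrow> real \<Rightarrow> (real^'n) measure" where
  "mvt \<xi> \<Omega> \<nu> = density lborel (\<lambda>x. ennreal (mvt_density \<xi> \<Omega> \<nu> x))"

definition vec_append :: "real^'q \<Rightarrow> real^'p \<Rightarrow> real^('q::finite + 'p::finite)" where
  "vec_append u v = (\<chi> i. case i of Inl j \<Rightarrow> u $ j | Inr j \<Rightarrow> v $ j)"

definition block_matrix ::
  "real^'q^'q \<Rightarrow> real^'p^'q \<Rightarrow> real^'q^'p \<Rightarrow> real^'p^'p \<Rightarrow>
   real^('q::finite + 'p::finite)^('q + 'p)" where
  "block_matrix A B C D =
     (\<chi> i. case i of Inl j \<Rightarrow> vec_append (A $ j) (B $ j) | Inr j \<Rightarrow> vec_append (C $ j) (D $ j))"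

definition sut_scale ::
  "real^'p^'p \<Rightarrow> real^'q^'p \<Rightarrow> real^'q^'q \<Rightarrow> real^('q::finite + 'p::finite)^('q + 'p)" where
  "sut_scale \<Sigma> \<Lambda> \<Psi> =
     block_matrix (\<Psi> + transpose \<Lambda> ** \<Lambda>) (transpose (mat_sqrt \<Sigma> ** \<Lambda>))
                  (mat_sqrt \<Sigma> ** \<Lambda>)               \<Sigma>"

text \<open>With \<open>X = (X\<^sub>1, X\<^sub>2)\<close> multivariate Student-t, \<open>X\<^sub>1\<close> being the \<open>Inl\<close>
  coordinates and \<open>X\<^sub>2\<close> the \<open>Inr\<close> coordinates, this is the law of \<open>X\<^sub>2\<close> given \<open>X\<^sub>1 > 0\<close>.\<close>
definition SUT ::
  "real^'p \<Rightarrow> real^'p^'p \<Rightarrow> real^'q^'p \<Rightarrow> real^'q \<Rightarrow> real \<Rightarrow> real^'q^'q \<Rightarrow> (real^'p::finite) measure" where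
  "SUT \<mu> \<Sigma> \<Lambda> \<tau> \<nu> \<Psi> =
     distr (uniform_measure (mvt (vec_append \<tau> \<mu>) (sut_scale \<Sigma> \<Lambda> \<Psi>) \<nu>) {x. \<forall>j. x $ Inl j > 0})
       borel (\<lambda>x. \<chi> i. x $ Inr i)"

end

theory Submission
  imports Defs
begin

text \<open>Up to constants, the density of the underlying \<open>(q + p)\<close>-dimensional Student law is
  \<open>(1 + norm x) powr - (\<nu> + q + p)\<close>, so the moment is finite iff the monomial is integrable against
  this weight over \<open>{x\<^sub>1 > 0, a \<le> x\<^sub>2 \<le> b}\<close>. That set is a product of rays, lines and bounded intervals; the
  \<open>q + p\<^sub>2\<close> unbounded coordinates \<open>U\<close> decide. If \<open>sum k\<^sub>2 + q + p\<^sub>2 < \<nu> + q + p\<close>, distributing the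
  exponent among them bounds the integral by a product of convergent one-dimensional ones; otherwise,
  boxes at the scales \<open>3 ^ n\<close> are disjoint and each contributes at least a fixed positive amount.\<close>

section \<open>Square roots of positive-definite matrices\<close>

text \<open>The two-sided comparison of the density needs a positive-definite scale matrix. Its
  off-diagonal blocks contain \<open>mat_sqrt \<Sigma>\<close>, a definite description, so existence
  and uniqueness of the root must be settled before anything can be said about that matrix.
  Location, skewness and correlation then enter through constants only. Each coordinate in
  \<open>U\<close> costs its exponent plus one, the one coming from volume. The coordinates of the
  conditioning block have exponent 0 and cost q in total, which cancels against the q in the tail
  exponent. A coordinate with two finite limits adds one to the tail exponent and nothing to the
  growth, whence the bound \<nu> + p1. At equality each box still contributes a fixed amount and the
  sum diverges, so the inequality is strict. Conditioning on the truncation also requires that event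
  to have positive probability; this is positivity of the same integral with all exponents
  zero.\<close>

lemma pos_def_coercive:
  fixes A :: "real^'n^'n"
  assumes "pos_def A"
  obtains m where "m > 0" "\<And>x. x \<bullet> (A *v x) \<ge> m * (norm x)\<^sup>2"
proof -
  \<comment> \<open>The constant is the minimum of the quadratic form over the compact unit sphere;
    homogeneity of degree two carries the bound to every vector.\<close>
  have "continuous_on (sphere 0 1) (\<lambda>x. x \<bullet> (A *v x))"
    by (intro continuous_intros linear_continuous_on matrix_vector_mul_bounded_linear)
  moreover have "sphere (0::real^'n) 1 \<noteq> {}"
    by simp
  ultimately have "\<exists>z\<in>sphere 0 1. \<forall>y\<in>sphere 0 1. z \<bullet> (A *v z) \<le> y \<bullet> (A *v y)"
    by (intro continuous_attains_inf compact_sphere)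
  then obtain z where z: "norm z = 1"
    "\<And>y. norm y = 1 \<Longrightarrow> z \<bullet> (A *v z) \<le> y \<bullet> (A *v y)"
    by auto
  show ?thesis
  proof
    have "z \<noteq> 0"
      using z(1) by auto
    then show "z \<bullet> (A *v z) > 0"
      using assms by (simp add: pos_def_def)
    fix x :: "real^'n"
    show "x \<bullet> (A *v x) \<ge> z \<bullet> (A *v z) * (norm x)\<^sup>2"
    proof (cases "x = 0")
      case False
      define y where "y = x /\<^sub>R norm x"
      have "x = norm x *\<^sub>R y"
        using False by (simp add: y_def)
      then have "x \<bullet> (A *v x) = (norm x)\<^sup>2 * (y \<bullet> (A *v y))"
        by (metis (no_types, lifting) inner_scaleR_left inner_scaleR_right matrix_vector_mult_scaleR
            mult.assoc power2_eq_square)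
      moreover have "z \<bullet> (A *v z) \<le> y \<bullet> (A *v y)"
        using False by (intro z) (simp add: y_def)
      ultimately show ?thesis
        by (simp add: mult.commute[of "(norm x)\<^sup>2"] mult_right_mono)
    qed simp
  qed
qed

lemma symmetric_inner_matrix:
  fixes A :: "real^'n^'n"
  assumes "transpose A = A"
  shows "x \<bullet> (A *v y) = (A *v x) \<bullet> y"
  by (metis assms dot_lmul_matrix transpose_matrix_vector)

text \<open>\<open>I - Y\<close> is a square root of \<open>I - T\<close> iff \<open>Y\<close> is a fixed point of
  \<open>Y \<mapsto> (T + Y\<^sup>2)/2\<close>, a contraction of the ball of radius \<open>1 - sqrt (1 - norm T)\<close>.\<close>
lemma blinfun_sqrt_fixed_point:
  fixes T :: "'a::euclidean_space \<Rightarrow>\<^sub>L 'a"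
  assumes T: "norm T < 1" "\<And>x y. x \<bullet> blinfun_apply T y = blinfun_apply T x \<bullet> y"
  shows "\<exists>Y :: 'a \<Rightarrow>\<^sub>L 'a. norm Y < 1 \<and>
    (\<forall>x y. x \<bullet> blinfun_apply Y y = blinfun_apply Y x \<bullet> y) \<and>
    (\<forall>x. 2 *\<^sub>R blinfun_apply Y x = blinfun_apply T x + blinfun_apply Y (blinfun_apply Y x))"
proof -
  \<comment> \<open>\<open>r\<close> is the smaller root of \<open>r = (norm T + r * r) / 2\<close>,
    so the norm estimate for \<open>F\<close> closes exactly at \<open>r\<close>; being below 1, it
    also serves as the contraction factor.\<close>
  define r where "r = 1 - sqrt (1 - norm T)"
  have r: "0 \<le> r" "r < 1" and r_eq: "(norm T + r * r) / 2 = r"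
    using T(1) by (auto simp: r_def algebra_simps diff_divide_distrib)
  \<comment> \<open>Self-adjointness is a closed condition preserved by \<open>F\<close>; building
    it into \<open>S\<close> hands it to the fixed point.\<close>
  define S where "S = {Y :: 'a \<Rightarrow>\<^sub>L 'a. norm Y \<le> r \<and> (\<forall>x y. x \<bullet> blinfun_apply Y y = blinfun_apply Y x \<bullet> y)}"
  define F where "F = (\<lambda>Y. (1/2) *\<^sub>R (T + (Y o\<^sub>L Y)))"
  have "closed S"
    unfolding S_def by (intro closed_Collect_conj closed_Collect_all closed_Collect_eq closed_Collect_le
        continuous_intros)
  moreover have "0 \<in> S"
    using r by (simp add: S_def)
  moreover have "F ` S \<subseteq> S"
  proof clarify
    fix Y assume Y: "Y \<in> S"
    have "norm (F Y) = norm (T + (Y o\<^sub>L Y)) / 2"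
      by (simp add: F_def)
    also have "\<dots> \<le> (norm T + norm Y * norm Y) / 2"
      by (intro divide_right_mono norm_triangle_le add_left_mono norm_blinfun_compose) simp
    also have "\<dots> \<le> (norm T + r * r) / 2"
      using Y by (intro divide_right_mono add_left_mono mult_mono) (auto simp: S_def r)
    finally have "norm (F Y) \<le> r"
      using r_eq by simp
    moreover have "x \<bullet> blinfun_apply (F Y) y = blinfun_apply (F Y) x \<bullet> y" for x y
      using Y T(2) by (simp add: F_def S_def blinfun.bilinear_simps inner_add_left inner_add_right)
    ultimately show "F Y \<in> S"
      by (simp add: S_def)
  qed
  moreover have "dist (F Y) (F Z) \<le> r * dist Y Z" if "Y \<in> S \<and> Z \<in> S" for Y Z
  proof -
    \<comment> \<open>The splitting Y Y - Z Z = Y (Y - Z) + (Y - Z) Z does not require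
      \<open>Y\<close> and \<open>Z\<close> to commute.\<close>
    have "F Y - F Z = (1/2) *\<^sub>R ((Y o\<^sub>L (Y - Z)) + ((Y - Z) o\<^sub>L Z))"
      by (simp add: F_def blinfun_eqI blinfun.bilinear_simps algebra_simps)
    then have "norm (F Y - F Z) \<le> (norm Y * norm (Y - Z) + norm (Y - Z) * norm Z) / 2"
      by (simp add: norm_triangle_le add_mono norm_blinfun_compose)
    also have "\<dots> \<le> (r * norm (Y - Z) + norm (Y - Z) * r) / 2"
      using that by (intro divide_right_mono add_mono mult_mono) (auto simp: S_def r)
    finally show ?thesis
      by (simp add: dist_norm)
  qed
  ultimately obtain Y where Y: "Y \<in> S" "F Y = Y"
    using Banach_fix[of S r F] r by (auto simp: complete_eq_closed)
  have "2 *\<^sub>R blinfun_apply Y x = blinfun_apply T x + blinfun_apply Y (blinfun_apply Y x)" for x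
    by (subst (1) Y(2)[symmetric]) (simp add: F_def blinfun.bilinear_simps)
  then show ?thesis
    using Y(1) r by (intro exI[of _ Y]) (auto simp: S_def)
qed

text \<open>For large \<open>c\<close> the operator T = I - A/c is a self-adjoint strict
  contraction. The fixed point \<open>Y\<close> satisfies (I - Y)^2 = I - T = A/c, so sqrt c (I - Y)
  is a root of \<open>A\<close>; it is positive definite because \<open>norm Y < 1\<close>.\<close>

lemma pos_def_sqrt_exists:
  fixes A :: "real^'n^'n"
  assumes A: "pos_def A"
  obtains B where "pos_def B" "B ** B = A"
proof -
  obtain m where m: "m > 0" "\<And>x. x \<bullet> (A *v x) \<ge> m * (norm x)\<^sup>2"
    using pos_def_coercive[OF A] by blast
  obtain K where K: "K > 0" "\<And>x. norm (A *v x) \<le> K * norm x"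
    using linear_bounded_pos[OF matrix_vector_mul_linear[of A]] by blast
  \<comment> \<open>The first summand ensures K^2 <= c m, which turns the expansion of the squared
    norm of T x into at most (1 - m/c) times that of x. The second ensures m <= c, so that this
    factor is nonnegative.\<close>
  define c where "c = K\<^sup>2 / m + m"
  have c: "c > 0" "c \<ge> m"
    using m K by (auto simp: c_def add_nonneg_pos)
  have sym: "transpose A = A"
    using A by (simp add: pos_def_def)
  define T where "T = Blinfun (\<lambda>x. x - (1/c) *\<^sub>R (A *v x))"
  have T: "blinfun_apply T x = x - (1/c) *\<^sub>R (A *v x)" for x
    unfolding T_def by (subst bounded_linear_Blinfun_apply)
      (intro bounded_linear_intros matrix_vector_mul_bounded_linear, simp)
  have "norm (blinfun_apply T x) \<le> sqrt (1 - m / c) * norm x" for x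
  proof -
    have "(norm (A *v x))\<^sup>2 \<le> (K * norm x)\<^sup>2"
      by (intro power_mono K) simp
    also have "\<dots> = K\<^sup>2 * (norm x)\<^sup>2"
      by (simp add: power_mult_distrib)
    also have "\<dots> \<le> (c * m) * (norm x)\<^sup>2"
      using m by (intro mult_right_mono) (auto simp: c_def algebra_simps)
    finally have *: "(norm (A *v x))\<^sup>2 \<le> (c * m) * (norm x)\<^sup>2" .
    have "(norm (blinfun_apply T x))\<^sup>2 = (norm x)\<^sup>2 - 2 * (x \<bullet> (A *v x)) / c + (norm (A *v x))\<^sup>2 / c\<^sup>2"
      unfolding T power2_norm_eq_inner using c
      by (simp add: inner_diff_left inner_diff_right inner_commute power2_eq_square field_simps)
    also have "\<dots> \<le> (norm x)\<^sup>2 - 2 * (m * (norm x)\<^sup>2) / c + ((c * m) * (norm x)\<^sup>2) / c\<^sup>2"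
      using c m * by (intro add_mono diff_mono divide_right_mono mult_left_mono) auto
    also have "\<dots> = (1 - m / c) * (norm x)\<^sup>2"
      using c by (simp add: field_simps power2_eq_square)
    also have "\<dots> = (sqrt (1 - m / c) * norm x)\<^sup>2"
      using c by (simp add: power_mult_distrib)
    finally show ?thesis
      by (rule power2_le_imp_le) (use c in auto)
  qed
  then have "norm T \<le> sqrt (1 - m / c)"
    using c by (intro norm_blinfun_bound) auto
  also have "\<dots> < 1"
    using c m by simp
  finally have "norm T < 1" .
  moreover have "x \<bullet> blinfun_apply T y = blinfun_apply T x \<bullet> y" for x y
    by (simp add: T inner_diff_left inner_diff_right symmetric_inner_matrix[OF sym])
  ultimately obtain Y :: "(real^'n) \<Rightarrow>\<^sub>L (real^'n)" where Y: "norm Y < 1" "\<forall>x y. x \<bullet> blinfun_apply Y y = blinfun_apply Y x \<bullet> y"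
    "\<forall>x. 2 *\<^sub>R blinfun_apply Y x = blinfun_apply T x + blinfun_apply Y (blinfun_apply Y x)"
    using blinfun_sqrt_fixed_point by blast
  define B where "B = matrix (\<lambda>x. sqrt c *\<^sub>R (x - blinfun_apply Y x))"
  have B: "B *v x = sqrt c *\<^sub>R (x - blinfun_apply Y x)" for x
  proof -
    have "linear (\<lambda>x. sqrt c *\<^sub>R (x - blinfun_apply Y x))"
      by (intro linearI) (auto simp: blinfun.bilinear_simps algebra_simps)
    from fun_cong[OF matrix_vector_mul(2)[OF this]] show ?thesis
      by (simp add: B_def)
  qed
  show ?thesis
  proof
    have "x \<bullet> (B *v y) = (B *v x) \<bullet> y" for x y
      by (simp add: B inner_diff_left inner_diff_right Y)
    then have "transpose B *v x = B *v x" for x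
      by (metis dot_lmul_matrix transpose_matrix_vector vector_eq_rdot)
    then have "transpose B = B"
      by (simp add: matrix_eq)
    moreover have "x \<bullet> (B *v x) > 0" if "x \<noteq> 0" for x
    proof -
      have "x \<bullet> blinfun_apply Y x \<le> norm x * norm (blinfun_apply Y x)"
        by (rule norm_cauchy_schwarz)
      also have "\<dots> \<le> norm x * (norm Y * norm x)"
        by (intro mult_left_mono norm_blinfun) auto
      also have "\<dots> < norm x * norm x"
        using that Y(1) by simp
      finally show ?thesis
        using c by (simp add: B inner_diff_right dot_square_norm power2_eq_square)
    qed
    ultimately show "pos_def B"
      by (simp add: pos_def_def)
    have "B *v (B *v x) = A *v x" for x
    proof -
      have "B *v (B *v x) = c *\<^sub>R (x - 2 *\<^sub>R blinfun_apply Y x + blinfun_apply Y (blinfun_apply Y x))"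
        using c by (simp add: B blinfun.bilinear_simps algebra_simps scaleR_2 flip: power2_eq_square)
      also have "\<dots> = A *v x"
        using c by (simp add: Y(3) T algebra_simps)
      finally show ?thesis .
    qed
    then show "B ** B = A"
      by (simp add: matrix_eq matrix_vector_mul_assoc)
  qed
qed

text \<open>Symmetry makes the rows of \<open>D\<close> its columns, so each diagonal entry of D B D
  is the quadratic form of \<open>B\<close> at a column. A vanishing trace can thereby be tested
  column by column.\<close>

lemma trace_congruence:
  fixes D B :: "real^'n^'n"
  assumes "transpose D = D"
  shows "trace (D ** (B ** D)) = (\<Sum>i\<in>UNIV. column i D \<bullet> (B *v column i D))"
proof -
  have "(D ** (B ** D)) $ i $ i = column i D \<bullet> (B *v column i D)" for i
  proof -
    have "row i D = column i D"
      using row_transpose[of i D] assms by simp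
    then show ?thesis
      by (simp add: matrix_matrix_mult_def matrix_vector_mult_def inner_vec_def column_def row_def vec_eq_iff)
  qed
  then show ?thesis
    by (simp add: trace_def)
qed

text \<open>With \<open>D = B - C\<close>, \<open>B\<^sup>2 = C\<^sup>2\<close> gives \<open>BD + DC = 0\<close>, so \<open>tr (DBD) + tr (DCD) = 0\<close>,
  where both summands are nonnegative.\<close>
lemma pos_def_sqrt_unique:
  fixes B C :: "real^'n^'n"
  assumes B: "pos_def B" and C: "pos_def C" and eq: "B ** B = C ** C"
  shows "B = C"
proof -
  define D where "D = B - C"
  have D: "transpose D = D"
    using B C by (simp add: D_def pos_def_def transpose_def vec_eq_iff)
  have "B ** D + D ** C = 0"
  proof -
    have "B *v (B *v x) = C *v (C *v x)" for x
      by (simp add: matrix_vector_mul_assoc eq)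
    then show ?thesis
      by (simp add: matrix_eq D_def matrix_vector_mult_add_rdistrib matrix_vector_mult_diff_rdistrib
          matrix_vector_mult_diff_distrib flip: matrix_vector_mul_assoc)
  qed
  then have "trace (D ** (B ** D)) + trace (D ** (D ** C)) = trace (D ** 0)"
    by (metis matrix_add_ldistrib trace_add)
  moreover have "trace (D ** (D ** C)) = trace (D ** (C ** D))"
    by (metis matrix_mul_assoc trace_mul_sym)
  ultimately have "(\<Sum>i\<in>UNIV. column i D \<bullet> (B *v column i D)) + (\<Sum>i\<in>UNIV. column i D \<bullet> (C *v column i D)) = 0"
    unfolding trace_congruence[OF D, symmetric] by (simp add: trace_def)
  moreover have nonneg: "v \<bullet> (B *v v) \<ge> 0" "v \<bullet> (C *v v) \<ge> 0" for v
    using B C by (cases "v = 0"; simp add: pos_def_def less_imp_le)+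
  ultimately have "(\<Sum>i\<in>UNIV. column i D \<bullet> (B *v column i D)) = 0"
    by (smt (verit) sum_nonneg)
  then have "column i D \<bullet> (B *v column i D) = 0" for i
    using nonneg by (simp add: sum_nonneg_eq_0_iff)
  then have "column i D = 0" for i
    using B by (metis less_irrefl pos_def_def)
  then have "D = 0"
    by (simp add: column_def vec_eq_iff)
  then show ?thesis
    by (simp add: D_def)
qed

text \<open>Unique existence gives the definite description its meaning; all later arguments about
  the root rest on these two facts.\<close>

lemma mat_sqrt:
  fixes A :: "real^'n^'n"
  assumes "pos_def A"
  shows "pos_def (mat_sqrt A)" and "mat_sqrt A ** mat_sqrt A = A"
proof -
  have "\<exists>!B. pos_def B \<and> B ** B = A"
    using pos_def_sqrt_exists[OF assms] pos_def_sqrt_unique by metis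
  from theI'[OF this] show "pos_def (mat_sqrt A)" and "mat_sqrt A ** mat_sqrt A = A"
    by (simp_all add: mat_sqrt_def)
qed

lemma pos_def_invertible:
  fixes A :: "real^'n^'n"
  assumes "pos_def A"
  shows "invertible A"
proof -
  have "\<forall>x. A *v x = 0 \<longrightarrow> x = 0"
    using assms by (metis inner_zero_right less_irrefl pos_def_def)
  then show ?thesis
    by (simp add: invertible_left_inverse matrix_left_invertible_ker)
qed

text \<open>The determinant is the square of the nonzero determinant of the root, so no eigenvalues
  are involved. This makes the normalising constant of the Student density positive.\<close>

lemma pos_def_det_pos:
  fixes A :: "real^'n^'n"
  assumes "pos_def A"
  shows "det A > 0"
proof -
  have "det A = (det (mat_sqrt A))\<^sup>2"
    using mat_sqrt(2)[OF assms] by (metis det_mul power2_eq_square)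
  moreover have "det (mat_sqrt A) \<noteq> 0"
    using pos_def_invertible[OF mat_sqrt(1)[OF assms]] by (simp add: invertible_det_nz)
  ultimately show ?thesis
    by simp
qed

section \<open>The scale matrix and the tails of the density\<close>

lemma sum_UNIV_Plus:
  fixes f :: "'a::finite + 'b::finite \<Rightarrow> 'c::comm_monoid_add"
  shows "sum f UNIV = (\<Sum>i\<in>UNIV. f (Inl i)) + (\<Sum>i\<in>UNIV. f (Inr i))"
  by (subst UNIV_Plus_UNIV[symmetric], subst sum.Plus) auto

lemma prod_UNIV_Plus:
  fixes f :: "'a::finite + 'b::finite \<Rightarrow> 'c::comm_monoid_mult"
  shows "prod f UNIV = (\<Prod>i\<in>UNIV. f (Inl i)) * (\<Prod>i\<in>UNIV. f (Inr i))"
  by (subst UNIV_Plus_UNIV[symmetric], subst prod.Plus) auto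

lemma inner_vec_append: "vec_append u v \<bullet> vec_append u' v' = u \<bullet> u' + v \<bullet> v'"
  by (simp add: inner_vec_def vec_append_def sum_UNIV_Plus)

lemma block_matrix_mult_vec_append:
  "block_matrix A B C D *v vec_append u v = vec_append (A *v u + B *v v) (C *v u + D *v v)"
  by (simp add: vec_eq_iff block_matrix_def matrix_vector_mult_def vec_append_def sum_UNIV_Plus
      split: sum.split)

lemma vec_append_surj: "x = vec_append (\<chi> j. x $ Inl j) (\<chi> i. x $ Inr i)"
  by (simp add: vec_eq_iff vec_append_def split: sum.split)

text \<open>The quadratic form of the scale matrix at \<open>(u, v)\<close> is
  \<open>u\<^sup>T \<Psi> u + norm (\<Lambda> u + \<Sigma>\<^sup>1\<^sup>/\<^sup>2 v)\<^sup>2\<close>.\<close>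
lemma pos_def_sut_scale:
  fixes \<Sigma> :: "real^'p^'p" and \<Psi> :: "real^'q^'q"
  assumes \<Sigma>: "pos_def \<Sigma>" and \<Psi>: "pos_def \<Psi>"
  shows "pos_def (sut_scale \<Sigma> \<Lambda> \<Psi>)"
proof -
  define R where "R = mat_sqrt \<Sigma>"
  have R: "pos_def R" "R ** R = \<Sigma>"
    using mat_sqrt[OF \<Sigma>] by (simp_all add: R_def)
  then have R_sym: "transpose R = R"
    by (simp add: pos_def_def)
  have sym: "\<Sigma> $ i $ j = \<Sigma> $ j $ i" "\<Psi> $ k $ l = \<Psi> $ l $ k" for i j k l
    using \<Sigma> \<Psi> by (auto simp: pos_def_def transpose_def vec_eq_iff)
  have "transpose (sut_scale \<Sigma> \<Lambda> \<Psi>) = sut_scale \<Sigma> \<Lambda> \<Psi>"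
    using sym by (auto simp: vec_eq_iff sut_scale_def block_matrix_def vec_append_def transpose_def
        matrix_matrix_mult_def mult.commute split: sum.split)
  moreover have "x \<bullet> (sut_scale \<Sigma> \<Lambda> \<Psi> *v x) > 0" if "x \<noteq> 0" for x
  proof -
    define u where "u = (\<chi> j. x $ Inl j)"
    define v where "v = (\<chi> i. x $ Inr i)"
    have x: "x = vec_append u v"
      unfolding u_def v_def by (rule vec_append_surj)
    \<comment> \<open>The four identities express the blocks through \<open>\<Lambda> *v u\<close>
      and \<open>R *v v\<close>, so that everything except the \<open>\<Psi>\<close> term becomes a
      complete square.\<close>
    have 1: "u \<bullet> ((transpose \<Lambda> ** \<Lambda>) *v u) = (\<Lambda> *v u) \<bullet> (\<Lambda> *v u)"
      by (metis dot_lmul_matrix matrix_vector_mul_assoc vector_transpose_matrix)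
    have 2: "u \<bullet> (transpose (R ** \<Lambda>) *v v) = (\<Lambda> *v u) \<bullet> (R *v v)"
      by (metis R_sym dot_lmul_matrix matrix_transpose_mul matrix_vector_mul_assoc vector_transpose_matrix)
    have 3: "v \<bullet> ((R ** \<Lambda>) *v u) = (R *v v) \<bullet> (\<Lambda> *v u)"
      by (simp add: symmetric_inner_matrix[OF R_sym] flip: matrix_vector_mul_assoc)
    have 4: "v \<bullet> (\<Sigma> *v v) = (R *v v) \<bullet> (R *v v)"
      by (simp add: symmetric_inner_matrix[OF R_sym] flip: matrix_vector_mul_assoc R(2))
    have "x \<bullet> (sut_scale \<Sigma> \<Lambda> \<Psi> *v x) = u \<bullet> (\<Psi> *v u) + u \<bullet> ((transpose \<Lambda> ** \<Lambda>) *v u)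
        + u \<bullet> (transpose (R ** \<Lambda>) *v v) + v \<bullet> ((R ** \<Lambda>) *v u) + v \<bullet> (\<Sigma> *v v)"
      unfolding x sut_scale_def R_def[symmetric]
      by (simp add: block_matrix_mult_vec_append inner_vec_append matrix_vector_mult_add_rdistrib
          inner_add_right)
    also have "\<dots> = u \<bullet> (\<Psi> *v u) + (\<Lambda> *v u + R *v v) \<bullet> (\<Lambda> *v u + R *v v)"
      unfolding 1 2 3 4 by (simp add: inner_add_left inner_add_right)
    finally have eq: "x \<bullet> (sut_scale \<Sigma> \<Lambda> \<Psi> *v x) = u \<bullet> (\<Psi> *v u) + (\<Lambda> *v u + R *v v) \<bullet> (\<Lambda> *v u + R *v v)" .
    show ?thesis
    proof (cases "u = 0")
      case True
      have "vec_append 0 0 = (0 :: real^('q + 'p))"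
        by (simp add: vec_append_def vec_eq_iff split: sum.split)
      then have "v \<noteq> 0"
        using that True by (auto simp: x)
      then have "R *v v \<noteq> 0"
        using R(1) by (metis inner_zero_right less_irrefl pos_def_def)
      then show ?thesis
        by (simp add: eq True)
    next
      case False
      then have "u \<bullet> (\<Psi> *v u) > 0"
        using \<Psi> by (simp add: pos_def_def)
      then show ?thesis
        unfolding eq by (simp add: add_pos_nonneg)
    qed
  qed
  ultimately show ?thesis
    by (simp add: pos_def_def)
qed

text \<open>Writing y = A z turns the inverse form into the form of \<open>A\<close> at
  \<open>z\<close>, which is coercive. Since norm y <= K norm z, coercivity in \<open>z\<close>
  gives the lower constant m / K^2 in \<open>y\<close>; the upper one is a Lipschitz bound for the
  inverse.\<close>

lemma pos_def_inverse_form_bounds: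
  fixes A :: "real^'n^'n"
  assumes A: "pos_def A"
  shows "\<exists>l>0. \<exists>u>0. \<forall>y. l * (norm y)\<^sup>2 \<le> y \<bullet> (matrix_inv A *v y) \<and> y \<bullet> (matrix_inv A *v y) \<le> u * (norm y)\<^sup>2"
proof -
  obtain m where m: "m > 0" "\<And>x. x \<bullet> (A *v x) \<ge> m * (norm x)\<^sup>2"
    using pos_def_coercive[OF A] by blast
  obtain K where K: "K > 0" "\<And>x. norm (A *v x) \<le> K * norm x"
    using linear_bounded_pos[OF matrix_vector_mul_linear[of A]] by blast
  obtain u where u: "u > 0" "\<And>x. norm (matrix_inv A *v x) \<le> u * norm x"
    using linear_bounded_pos[OF matrix_vector_mul_linear[of "matrix_inv A"]] by blast
  have "\<exists>A'. A ** A' = mat 1 \<and> A' ** A = mat 1"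
    using pos_def_invertible[OF A] by (simp add: invertible_def)
  then have inv: "A ** matrix_inv A = mat 1"
    unfolding matrix_inv_def by (rule someI2_ex) simp
  have "(m / K\<^sup>2) * (norm y)\<^sup>2 \<le> y \<bullet> (matrix_inv A *v y) \<and> y \<bullet> (matrix_inv A *v y) \<le> u * (norm y)\<^sup>2" for y
  proof
    define z where "z = matrix_inv A *v y"
    have y: "y = A *v z"
      by (simp add: z_def matrix_vector_mul_assoc inv)
    have "(norm y)\<^sup>2 \<le> (K * norm z)\<^sup>2"
      unfolding y by (intro power_mono K) simp
    then have "(m / K\<^sup>2) * (norm y)\<^sup>2 \<le> m * (norm z)\<^sup>2"
      using K m by (simp add: power_mult_distrib field_simps)
    also have "\<dots> \<le> z \<bullet> y"
      unfolding y by (rule m)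
    finally show "(m / K\<^sup>2) * (norm y)\<^sup>2 \<le> y \<bullet> (matrix_inv A *v y)"
      by (simp add: z_def inner_commute)
    have "y \<bullet> z \<le> norm y * norm z"
      by (rule norm_cauchy_schwarz)
    also have "\<dots> \<le> norm y * (u * norm y)"
      unfolding z_def by (intro mult_left_mono u) simp
    finally show "y \<bullet> (matrix_inv A *v y) \<le> u * (norm y)\<^sup>2"
      by (simp add: z_def power2_eq_square mult_ac)
  qed
  moreover have "m / K\<^sup>2 > 0"
    using m K by simp
  ultimately show ?thesis
    using u(1) by blast
qed

text \<open>The base \<open>P x\<close> of the density is comparable to (1 + norm x)^2. The negative
  power -N/2 halves the square to the stated exponent and reverses the inequalities, so
  \<open>d2\<close> yields the lower and \<open>d1\<close> the upper constant.\<close>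

lemma mvt_density_bounds:
  fixes \<xi> :: "real^'n"
  assumes \<Omega>: "pos_def \<Omega>" and \<nu>: "\<nu> > 0"
  shows "\<exists>c1>0. \<exists>c2>0. \<forall>x.
    c1 * (1 + norm x) powr - (\<nu> + real CARD('n)) \<le> mvt_density \<xi> \<Omega> \<nu> x \<and>
    mvt_density \<xi> \<Omega> \<nu> x \<le> c2 * (1 + norm x) powr - (\<nu> + real CARD('n))"
proof -
  define N where "N = \<nu> + real CARD('n)"
  have N: "N > 0"
    using \<nu> by (simp add: N_def)
  define C where "C = Gamma (N / 2) /
    (Gamma (\<nu> / 2) * (\<nu> * pi) powr (real CARD('n) / 2) * sqrt (det \<Omega>))"
  have C: "C > 0"
    using N \<nu> pos_def_det_pos[OF \<Omega>] by (simp add: C_def Gamma_real_pos)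
  define P where "P x = 1 + ((x - \<xi>) \<bullet> (matrix_inv \<Omega> *v (x - \<xi>))) / \<nu>" for x
  have dens: "mvt_density \<xi> \<Omega> \<nu> x = C * P x powr (- (N / 2))" for x
  proof -
    have "mvt_density \<xi> \<Omega> \<nu> x = C * P x powr (- N / 2)"
      by (simp only: mvt_density_def C_def N_def P_def)
    then show ?thesis
      by simp
  qed
  obtain l u where l: "l > 0" and u: "u > 0"
    and l_le: "\<And>y. l * (norm y)\<^sup>2 \<le> y \<bullet> (matrix_inv \<Omega> *v y)"
    and u_ge: "\<And>y. y \<bullet> (matrix_inv \<Omega> *v y) \<le> u * (norm y)\<^sup>2"
    using pos_def_inverse_form_bounds[OF \<Omega>] by metis
  \<comment> \<open>\<open>d1\<close> comes from bounding (1 + norm x)^2 by 2 (1 + norm \<xi>)^2 + 2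
    (norm (x - \<xi>))^2 and comparing the summands with the constant and the quadratic part of
    \<open>P\<close>. \<open>d2\<close> comes from norm (x - \<xi>) <= (1 + norm \<xi>) (1 + norm
    x).\<close>
  define d1 where "d1 = 1 / (2 * (1 + norm \<xi>)\<^sup>2 + 2 * \<nu> / l)"
  define d2 where "d2 = 1 + u * (1 + norm \<xi>)\<^sup>2 / \<nu>"
  have d: "d1 > 0" "d2 > 0"
  proof -
    have "2 * (1 + norm \<xi>)\<^sup>2 + 2 * \<nu> / l > 0"
      using l \<nu> by (intro add_nonneg_pos) auto
    then show "d1 > 0"
      by (simp add: d1_def)
    show "d2 > 0"
      unfolding d2_def using u \<nu> by (intro add_pos_nonneg) auto
  qed
  have P_ge: "d1 * (1 + norm x)\<^sup>2 \<le> P x" for x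
  proof -
    have "(1 + norm x)\<^sup>2 \<le> ((1 + norm \<xi>) + norm (x - \<xi>))\<^sup>2"
      by (intro power_mono) (use norm_triangle_sub[of x \<xi>] in auto)
    also have "\<dots> \<le> 2 * (1 + norm \<xi>)\<^sup>2 + 2 * (norm (x - \<xi>))\<^sup>2"
      using sum_squares_bound[of "1 + norm \<xi>" "norm (x - \<xi>)"] by (simp add: power2_sum)
    also have "\<dots> = 2 * (1 + norm \<xi>)\<^sup>2 + (2 * \<nu> / l) * (l * (norm (x - \<xi>))\<^sup>2 / \<nu>)"
      using l \<nu> by simp
    also have "\<dots> \<le> (2 * (1 + norm \<xi>)\<^sup>2 + 2 * \<nu> / l) * (1 + l * (norm (x - \<xi>))\<^sup>2 / \<nu>)"
    proof -
      have *: "a + b * c \<le> (a + b) * (1 + c)" if "a \<ge> 0" "b \<ge> 0" "c \<ge> 0" for a b c :: real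
        using that by (simp add: algebra_simps)
      show ?thesis
        by (rule *) (use l \<nu> in auto)
    qed
    also have "1 + l * (norm (x - \<xi>))\<^sup>2 / \<nu> \<le> P x"
      unfolding P_def using \<nu> by (intro add_left_mono divide_right_mono l_le) auto
    finally have "(1 + norm x)\<^sup>2 \<le> (2 * (1 + norm \<xi>)\<^sup>2 + 2 * \<nu> / l) * P x"
      using l \<nu> by (simp add: mult_left_mono)
    moreover have "2 * (1 + norm \<xi>)\<^sup>2 + 2 * \<nu> / l > 0"
      using l \<nu> by (simp add: add_nonneg_pos)
    ultimately show ?thesis
      by (simp add: d1_def divide_le_eq mult.commute)
  qed
  have P_le: "P x \<le> d2 * (1 + norm x)\<^sup>2" for x
  proof -
    have "norm (x - \<xi>) \<le> (1 + norm \<xi>) * (1 + norm x)"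
      using norm_triangle_ineq4[of x \<xi>] mult_nonneg_nonneg[OF norm_ge_zero norm_ge_zero, of \<xi> x]
      unfolding distrib_left distrib_right by linarith
    then have "(norm (x - \<xi>))\<^sup>2 \<le> ((1 + norm \<xi>) * (1 + norm x))\<^sup>2"
      by (intro power_mono) auto
    then have "u * (norm (x - \<xi>))\<^sup>2 / \<nu> \<le> u * ((1 + norm \<xi>) * (1 + norm x))\<^sup>2 / \<nu>"
      using u \<nu> by (intro divide_right_mono mult_left_mono) auto
    moreover have "P x \<le> 1 + u * (norm (x - \<xi>))\<^sup>2 / \<nu>"
      unfolding P_def using \<nu> by (intro add_left_mono divide_right_mono u_ge) auto
    moreover have "1 \<le> (1 + norm x)\<^sup>2"
      by simp
    ultimately have "P x \<le> (1 + norm x)\<^sup>2 + u * ((1 + norm \<xi>) * (1 + norm x))\<^sup>2 / \<nu>"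
      by linarith
    then show ?thesis
      unfolding d2_def power_mult_distrib by (simp add: algebra_simps)
  qed
  have sq: "((1 + norm x)\<^sup>2) powr (- (N / 2)) = (1 + norm x) powr - N" for x :: "real^'n"
    by (simp add: powr_powr flip: powr_numeral)
  have pos: "(1 + norm x)\<^sup>2 > 0" for x :: "real^'n"
    by (intro zero_less_power add_pos_nonneg) auto
  have "C * d2 powr (- (N / 2)) * (1 + norm x) powr - (\<nu> + real CARD('n)) \<le> mvt_density \<xi> \<Omega> \<nu> x \<and>
    mvt_density \<xi> \<Omega> \<nu> x \<le> C * d1 powr (- (N / 2)) * (1 + norm x) powr - (\<nu> + real CARD('n))" for x
  proof
    have Px: "P x > 0"
      by (rule less_le_trans[OF mult_pos_pos[OF d(1) pos] P_ge])
    have "(d2 * (1 + norm x)\<^sup>2) powr (- (N / 2)) \<le> P x powr (- (N / 2))"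
      using P_le Px N by (intro powr_mono2') auto
    then show "C * d2 powr (- (N / 2)) * (1 + norm x) powr - (\<nu> + real CARD('n)) \<le> mvt_density \<xi> \<Omega> \<nu> x"
      unfolding dens using C d by (simp add: powr_mult sq flip: N_def)
    have "P x powr (- (N / 2)) \<le> (d1 * (1 + norm x)\<^sup>2) powr (- (N / 2))"
      using P_ge d pos N by (intro powr_mono2') auto
    then show "mvt_density \<xi> \<Omega> \<nu> x \<le> C * d1 powr (- (N / 2)) * (1 + norm x) powr - (\<nu> + real CARD('n))"
      unfolding dens using C d by (simp add: powr_mult sq flip: N_def)
  qed
  moreover have "C * d2 powr (- (N / 2)) > 0" "C * d1 powr (- (N / 2)) > 0"
    using C d by simp_all
  ultimately show ?thesis
    by blast
qed

section \<open>Integrals of monomials against a power of the norm\<close>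

text \<open>This is Tonelli in coordinates: the product rule for \<open>lborel\<close> is indexed by
  \<open>Basis\<close>, and the injection sending \<open>i\<close> to \<open>axis i 1\<close>
  replaces basis vectors by indices.\<close>

lemma nn_integral_lborel_prod_vec:
  fixes f :: "'n::finite \<Rightarrow> real \<Rightarrow> ennreal"
  assumes [measurable]: "\<And>i. f i \<in> borel_measurable borel"
  shows "(\<integral>\<^sup>+x. (\<Prod>i\<in>UNIV. f i (x $ i)) \<partial>lborel) = (\<Prod>i\<in>UNIV. \<integral>\<^sup>+t. f i t \<partial>lborel)"
proof -
  have Basis: "Basis = range (\<lambda>i::'n. axis i (1::real))"
    by (auto simp: Basis_vec_def)
  have inj: "inj (\<lambda>i::'n. axis i (1::real))"
    by (auto simp: inj_on_def axis_eq_axis)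
  have index: "axis_index (axis i (1::real)) = i" for i :: 'n
    using axis_index[of "axis i (1::real)"] by (simp add: axis_eq_axis)
  have "(\<integral>\<^sup>+x. (\<Prod>b\<in>(Basis :: (real^'n) set). f (axis_index b) (x \<bullet> b)) \<partial>lborel) =
    (\<Prod>b\<in>(Basis :: (real^'n) set). \<integral>\<^sup>+t. f (axis_index b) t \<partial>lborel)"
    by (rule nn_integral_lborel_prod) auto
  then show ?thesis
    unfolding Basis prod.reindex[OF inj] by (simp add: index inner_axis)
qed

lemma nn_integral_powr_finite:
  assumes e: "e > (0::real)"
  shows "(\<integral>\<^sup>+t. ennreal ((1 + \<bar>t\<bar>) powr - (1 + e)) \<partial>lborel) < \<infinity>"
proof -
  define g where "g = (\<lambda>t::real. ennreal ((1 + t) powr - (1 + e)) * indicator {0..} t)"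
  have [measurable]: "g \<in> borel_measurable borel"
    by (simp add: g_def)
  define F where "F t = (1 + t) powr (- e) / (- e)" for t
  have "((\<lambda>t. (1 + t) powr (- e)) \<longlongrightarrow> 0) at_top"
    using e by (intro tendsto_neg_powr filterlim_tendsto_add_at_top[OF tendsto_const] filterlim_ident) auto
  then have "(F \<longlongrightarrow> 0) at_top"
    unfolding F_def by (rule tendsto_divide_zero)
  moreover have "(F has_real_derivative (1 + t) powr - (1 + e)) (at t)" if "t \<ge> 0" for t
  proof -
    have eq: "- (1 + e) = - e - 1"
      by simp
    show ?thesis
      unfolding F_def eq using that e by (auto intro!: derivative_eq_intros simp: field_simps)
  qed
  ultimately have "nn_integral lborel g = ennreal (0 - F 0)"
    unfolding g_def by (intro nn_integral_FTC_atLeast) auto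
  then have fin: "nn_integral lborel g < \<infinity>"
    by simp
  \<comment> \<open>The line is covered by a half-line and its reflection; both count the origin,
    which is harmless for an upper bound.\<close>
  have "(\<integral>\<^sup>+t. ennreal ((1 + \<bar>t\<bar>) powr - (1 + e)) \<partial>lborel) \<le> (\<integral>\<^sup>+t. g t + g (- t) \<partial>lborel)"
    by (intro nn_integral_mono) (auto simp: g_def indicator_def)
  also have "\<dots> = nn_integral lborel g + (\<integral>\<^sup>+t. g (- t) \<partial>lborel)"
    by (intro nn_integral_add) auto
  also have "(\<integral>\<^sup>+t. g (- t) \<partial>lborel) = nn_integral lborel g"
    using nn_integral_real_affine[of g "-1" 0] by simp
  finally show ?thesis
    using fin by (simp add: le_less_trans)
qed

lemma ennreal_prod_less_top:
  fixes f :: "'a \<Rightarrow> ennreal"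
  assumes "\<And>i. i \<in> I \<Longrightarrow> f i < \<infinity>"
  shows "prod f I < \<infinity>"
  using assms
proof (induction I rule: infinite_finite_induct)
  case (insert i I)
  then have "f i < \<infinity>" "prod f I < \<infinity>"
    by auto
  then show ?case
    using insert.hyps by (simp add: ennreal_mult_less_top)
qed simp_all

text \<open>Each factor \<open>1 + norm x\<close> dominates \<open>1 + \<bar>x\<^sub>i\<bar>\<close>; distributing the exponent \<open>N\<close> over the
  unbounded coordinates with weights \<open>k\<^sub>i + 1 + \<epsilon>\<close> reduces to one-dimensional integrals.\<close>
lemma nn_integral_monomial_finite:
  fixes A :: "'n::finite \<Rightarrow> real set" and k :: "'n \<Rightarrow> nat"
  assumes [measurable]: "\<And>i. A i \<in> sets borel"
    and bdd: "\<And>i. i \<notin> U \<Longrightarrow> bounded (A i)"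
    and less: "(\<Sum>i\<in>U. real (k i) + 1) < N"
  shows "(\<integral>\<^sup>+x. ennreal ((\<Prod>i\<in>UNIV. \<bar>x $ i\<bar> ^ k i) * (1 + norm x) powr - N) *
    indicator {x. \<forall>i. x $ i \<in> A i} x \<partial>lborel) < \<infinity>"
proof -
  \<comment> \<open>The slack in the hypothesis is shared among the coordinates of \<open>U\<close>.
    Dividing by \<open>1 + card U\<close> keeps \<open>e\<close> positive when \<open>U\<close> is
    empty, where division by \<open>card U\<close> would yield 0.\<close>
  define e where "e = (N - (\<Sum>i\<in>U. real (k i) + 1)) / (1 + card U)"
  have e: "e > 0"
    using less by (simp add: e_def)
  define w where "w i = (if i \<in> U then real (k i) + 1 + e else 0)" for i
  \<comment> \<open>One-dimensional majorants: on \<open>U\<close> the constraint is dropped and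
    decay of order 1 + e remains; elsewhere no decay is spent and boundedness of \<open>A i\<close>
    gives integrability.\<close>
  define g where "g i t = (if i \<in> U then (1 + \<bar>t\<bar>) powr - (1 + e)
    else \<bar>t\<bar> ^ k i * indicat_real (A i) t)" for i t
  have [measurable]: "g i \<in> borel_measurable borel" for i
    unfolding g_def by (cases "i \<in> U") auto
  have g_nonneg: "g i t \<ge> 0" for i t
    by (simp add: g_def)
  have "(\<Sum>i\<in>UNIV. w i) = (\<Sum>i\<in>U. real (k i) + 1 + e)"
    by (simp add: w_def sum.If_cases)
  also have "\<dots> = (\<Sum>i\<in>U. real (k i) + 1) + card U * e"
    by (simp add: sum.distrib)
  also have "\<dots> \<le> N"
  proof -
    have "card U * e \<le> (1 + card U) * e"
      using e by (intro mult_right_mono) auto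
    also have "\<dots> = N - (\<Sum>i\<in>U. real (k i) + 1)"
      by (simp add: e_def)
    finally show ?thesis
      by simp
  qed
  finally have w_sum: "(\<Sum>i\<in>UNIV. w i) \<le> N" .
  have w_nonneg: "w i \<ge> 0" for i
    using e by (simp add: w_def)
  have factor: "\<bar>t\<bar> ^ k i * (1 + \<bar>t\<bar>) powr - w i \<le> g i t" if "t \<in> A i" for i t
  proof (cases "i \<in> U")
    case True
    have "\<bar>t\<bar> ^ k i \<le> (1 + \<bar>t\<bar>) ^ k i"
      by (intro power_mono) auto
    also have "\<dots> = (1 + \<bar>t\<bar>) powr real (k i)"
      by (simp add: powr_realpow add_pos_nonneg)
    finally have "\<bar>t\<bar> ^ k i * (1 + \<bar>t\<bar>) powr - w i \<le> (1 + \<bar>t\<bar>) powr real (k i) * (1 + \<bar>t\<bar>) powr - w i"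
      by (intro mult_right_mono) auto
    also have "\<dots> = g i t"
      using True by (simp add: g_def w_def flip: powr_add)
    finally show ?thesis .
  qed (use that in \<open>simp add: g_def w_def\<close>)
  have bound: "(\<Prod>i\<in>UNIV. \<bar>x $ i\<bar> ^ k i) * (1 + norm x) powr - N \<le> (\<Prod>i\<in>UNIV. g i (x $ i))"
    if x: "\<forall>i. x $ i \<in> A i" for x :: "real^'n"
  proof -
    have "(1 + norm x) powr - N \<le> (1 + norm x) powr - (\<Sum>i\<in>UNIV. w i)"
      using w_sum by (intro powr_mono) auto
    also have "\<dots> = (\<Prod>i\<in>UNIV. (1 + norm x) powr - w i)"
      using powr_sum[of "1 + norm x" "\<lambda>i. - w i" UNIV]
      by (simp add: sum_negf add_pos_nonneg less_imp_neq[symmetric])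
    also have "\<dots> \<le> (\<Prod>i\<in>UNIV. (1 + \<bar>x $ i\<bar>) powr - w i)"
      using w_nonneg by (intro prod_mono conjI powr_mono2') (auto simp: component_le_norm_cart add_pos_nonneg)
    finally have "(\<Prod>i\<in>UNIV. \<bar>x $ i\<bar> ^ k i) * (1 + norm x) powr - N \<le>
      (\<Prod>i\<in>UNIV. \<bar>x $ i\<bar> ^ k i) * (\<Prod>i\<in>UNIV. (1 + \<bar>x $ i\<bar>) powr - w i)"
      by (intro mult_left_mono prod_nonneg) auto
    also have "\<dots> = (\<Prod>i\<in>UNIV. \<bar>x $ i\<bar> ^ k i * (1 + \<bar>x $ i\<bar>) powr - w i)"
      by (simp add: prod.distrib)
    also have "\<dots> \<le> (\<Prod>i\<in>UNIV. g i (x $ i))"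
      using x by (intro prod_mono) (auto intro: factor)
    finally show ?thesis .
  qed
  have "(\<integral>\<^sup>+x. ennreal ((\<Prod>i\<in>UNIV. \<bar>x $ i\<bar> ^ k i) * (1 + norm x) powr - N) *
      indicator {x. \<forall>i. x $ i \<in> A i} x \<partial>lborel) \<le> (\<integral>\<^sup>+x. (\<Prod>i\<in>UNIV. ennreal (g i (x $ i))) \<partial>lborel)"
    using bound by (intro nn_integral_mono)
      (auto simp: indicator_def prod_ennreal g_nonneg intro!: ennreal_leI)
  also have "\<dots> = (\<Prod>i\<in>UNIV. \<integral>\<^sup>+t. ennreal (g i t) \<partial>lborel)"
    by (rule nn_integral_lborel_prod_vec) auto
  also have "\<dots> < \<infinity>"
  proof (rule ennreal_prod_less_top)
    fix i
    show "(\<integral>\<^sup>+t. ennreal (g i t) \<partial>lborel) < \<infinity>"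
    proof (cases "i \<in> U")
      case True
      then show ?thesis
        using nn_integral_powr_finite[OF e] by (simp add: g_def)
    next
      case False
      then have "\<exists>b. \<forall>t\<in>A i. \<bar>t\<bar> \<le> b"
        using bdd by (simp add: bounded_real)
      then obtain b where b: "\<And>t. t \<in> A i \<Longrightarrow> \<bar>t\<bar> \<le> b"
        by blast
      have "(\<integral>\<^sup>+t. ennreal (g i t) \<partial>lborel) \<le> (\<integral>\<^sup>+t. ennreal (b ^ k i) * indicator {- b..b} t \<partial>lborel)"
        using False b by (intro nn_integral_mono)
          (auto simp: g_def indicator_def abs_le_iff intro!: ennreal_leI power_mono dest: b)
      also have "\<dots> = ennreal (b ^ k i) * emeasure lborel {- b..b}"
        by (intro nn_integral_cmult_indicator) auto
      also have "\<dots> < \<infinity>"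
        by (simp add: ennreal_mult_less_top emeasure_lborel_Icc_eq)
      finally show ?thesis .
    qed
  qed
  finally show ?thesis .
qed

text \<open>A monomial vanishes where a coordinate is zero, so a lower bound on a box needs bounded
  coordinates kept away from zero. Half of the part of the interval on one side of zero
  suffices.\<close>

lemma subinterval_away_from_zero:
  fixes c d :: real
  assumes "c < d"
  obtains c' d' e where "c' < d'" "{c'..d'} \<subseteq> {c..d}" "e > 0" "\<And>t. t \<in> {c'..d'} \<Longrightarrow> e \<le> \<bar>t\<bar>"
proof (cases "d > 0")
  case True
  define m where "m = max c 0"
  have "m < d" "0 \<le> m" "c \<le> m"
    using assms True by (auto simp: m_def)
  then show thesis
    by (intro that[of "(m + d) / 2" d "(m + d) / 2"]) auto
next
  case False
  then show thesis
    using assms by (intro that[of c "(c + d) / 2" "- (c + d) / 2"]) auto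
qed

text \<open>A box whose unbounded coordinates have size of order \<open>R\<close> has volume of order
  \<open>R ^ card U\<close>, and on it the integrand is at least of order \<open>R powr (\<Sum>i\<in>U. k i) * R powr - N\<close>.\<close>
lemma nn_integral_monomial_box:
  fixes A :: "'n::finite \<Rightarrow> real set" and k :: "'n \<Rightarrow> nat"
  assumes ray: "\<And>i. i \<in> U \<Longrightarrow> \<exists>s M. (s = 1 \<or> s = - 1) \<and> (\<forall>t\<ge>M. s * t \<in> A i)"
    and interval: "\<And>i. i \<notin> U \<Longrightarrow> \<exists>c d. c < d \<and> {c..d} \<subseteq> A i"
    and N: "N \<ge> 0"
  shows "\<exists>C>0. \<exists>R0\<ge>1. \<forall>R\<ge>R0. \<exists>T\<in>sets borel. T \<subseteq> {x::real^'n. \<forall>i. x $ i \<in> A i} \<and>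
    (\<forall>x\<in>T. \<forall>i\<in>U. R \<le> \<bar>x $ i\<bar> \<and> \<bar>x $ i\<bar> \<le> 2 * R) \<and>
    ennreal (C * R powr ((\<Sum>i\<in>U. real (k i) + 1) - N)) \<le>
      (\<integral>\<^sup>+x. ennreal ((\<Prod>i\<in>UNIV. \<bar>x $ i\<bar> ^ k i) * (1 + norm x) powr - N) * indicator T x \<partial>lborel)"
proof -
  obtain s M where s: "\<And>i. i \<in> U \<Longrightarrow> s i = 1 \<or> s i = - 1"
    and M: "\<And>i t. i \<in> U \<Longrightarrow> t \<ge> M i \<Longrightarrow> s i * t \<in> A i"
    using ray by metis
  have "\<exists>c d e. c < d \<and> {c..d} \<subseteq> A i \<and> e > 0 \<and> (\<forall>t\<in>{c..d}. e \<le> \<bar>t\<bar>)" if i: "i \<notin> U" for i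
  proof -
    obtain c d where cd: "c < d" "{c..d} \<subseteq> A i"
      using interval[OF i] by blast
    obtain c' d' e where "c' < d'" "{c'..d'} \<subseteq> {c..d}" "e > 0" "\<And>t. t \<in> {c'..d'} \<Longrightarrow> e \<le> \<bar>t\<bar>"
      using subinterval_away_from_zero[OF cd(1)] by metis
    then show ?thesis
      using cd(2) by (intro exI[of _ c'] exI[of _ d'] exI[of _ e]) auto
  qed
  then obtain c d e where cd: "\<And>i. i \<notin> U \<Longrightarrow> c i < d i" "\<And>i. i \<notin> U \<Longrightarrow> {c i..d i} \<subseteq> A i"
    and e: "\<And>i. i \<notin> U \<Longrightarrow> e i > 0" "\<And>i t. i \<notin> U \<Longrightarrow> t \<in> {c i..d i} \<Longrightarrow> e i \<le> \<bar>t\<bar>"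
    by metis
  \<comment> \<open>\<open>R0\<close> exceeds every threshold \<open>M i\<close>, so beyond it all
    rays are available. \<open>D\<close> is chosen such that \<open>1 + norm x \<le> D * R\<close>
    on the box, and \<open>C\<close> collects what remains once the powers of \<open>R\<close> are
    factored out.\<close>
  define R0 where "R0 = 1 + (\<Sum>i\<in>U. \<bar>M i\<bar>)"
  define D where "D = 1 + (\<Sum>i\<in>UNIV. 2 + \<bar>c i\<bar> + \<bar>d i\<bar>)"
  define C where "C = (\<Prod>i\<in>UNIV. if i \<in> U then 1 else e i ^ k i * (d i - c i)) * D powr - N"
  have D: "D > 0"
    unfolding D_def by (intro add_pos_nonneg sum_nonneg) auto
  have C: "C > 0"
    unfolding C_def using D cd e by (intro mult_pos_pos prod_pos) auto
  have R0: "R0 \<ge> 1"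
    by (simp add: R0_def sum_nonneg)
  have M_le: "M i \<le> R" if "i \<in> U" "R \<ge> R0" for i R
    using member_le_sum[of i U "\<lambda>i. \<bar>M i\<bar>"] that by (auto simp: R0_def)
  have "\<exists>T\<in>sets borel. T \<subseteq> {x::real^'n. \<forall>i. x $ i \<in> A i} \<and>
    (\<forall>x\<in>T. \<forall>i\<in>U. R \<le> \<bar>x $ i\<bar> \<and> \<bar>x $ i\<bar> \<le> 2 * R) \<and>
    ennreal (C * R powr ((\<Sum>i\<in>U. real (k i) + 1) - N)) \<le>
      (\<integral>\<^sup>+x. ennreal ((\<Prod>i\<in>UNIV. \<bar>x $ i\<bar> ^ k i) * (1 + norm x) powr - N) * indicator T x \<partial>lborel)"
    if R: "R \<ge> R0" for R
  proof -
    have R1: "R \<ge> 1"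
      using R R0 by simp
    \<comment> \<open>On \<open>U\<close> the side is [R, 2R] or its mirror image, according to the
      direction \<open>s i\<close> of the ray.\<close>
    define lo where "lo i = (if i \<in> U then (if s i = 1 then R else - 2 * R) else c i)" for i
    define hi where "hi i = (if i \<in> U then (if s i = 1 then 2 * R else - R) else d i)" for i
    define T where "T = cbox (\<chi> i. lo i) (\<chi> i. hi i)"
    have T: "x \<in> T \<longleftrightarrow> (\<forall>i. lo i \<le> x $ i \<and> x $ i \<le> hi i)" for x
      by (simp add: T_def mem_box_cart)
    have TU: "R \<le> s i * x $ i \<and> s i * x $ i \<le> 2 * R" if "x \<in> T" "i \<in> U" for x i
      using that s[OF that(2)] by (auto simp: T lo_def hi_def dest!: spec[of _ i] split: if_splits)
    have T_notU: "x $ i \<in> {c i..d i}" if "x \<in> T" "i \<notin> U" for x i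
      using that by (auto simp: T lo_def hi_def dest!: spec[of _ i])
    have abs_TU: "R \<le> \<bar>x $ i\<bar> \<and> \<bar>x $ i\<bar> \<le> 2 * R" if "x \<in> T" "i \<in> U" for x i
      using TU[OF that] s[OF that(2)] R1 by auto
    have mem: "x $ i \<in> A i" if "x \<in> T" for x i
    proof (cases "i \<in> U")
      case True
      have "s i * (s i * x $ i) \<in> A i"
        using M_le[OF True R] TU[OF that True] by (intro M True) auto
      moreover have "s i * (s i * x $ i) = x $ i"
        using s[OF True] by auto
      ultimately show ?thesis
        by simp
    next
      case False
      then show ?thesis
        using T_notU[OF that] cd by blast
    qed
    \<comment> \<open>\<open>v\<close> bounds the integrand below throughout \<open>T\<close>;
      multiplied by the volume of \<open>T\<close> it gives the claimed power of
      \<open>R\<close>.\<close>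
    define v where "v = (\<Prod>i\<in>UNIV. if i \<in> U then R ^ k i else e i ^ k i) * (D * R) powr - N"
    have v_le: "v \<le> (\<Prod>i\<in>UNIV. \<bar>x $ i\<bar> ^ k i) * (1 + norm x) powr - N" if x: "x \<in> T" for x
    proof -
      have comp: "\<bar>x $ i\<bar> \<le> (2 + \<bar>c i\<bar> + \<bar>d i\<bar>) * R" for i
      proof (cases "i \<in> U")
        case True
        have "0 \<le> (\<bar>c i\<bar> + \<bar>d i\<bar>) * R"
          using R1 by simp
        moreover have "(2 + \<bar>c i\<bar> + \<bar>d i\<bar>) * R = 2 * R + (\<bar>c i\<bar> + \<bar>d i\<bar>) * R"
          by (simp add: algebra_simps)
        ultimately show ?thesis
          using abs_TU[OF x True] by linarith
      next
        case False
        have "\<bar>x $ i\<bar> \<le> (2 + \<bar>c i\<bar> + \<bar>d i\<bar>) * 1"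
          using T_notU[OF x False] by auto
        also have "\<dots> \<le> (2 + \<bar>c i\<bar> + \<bar>d i\<bar>) * R"
          using R1 by (intro mult_left_mono) auto
        finally show ?thesis .
      qed
      have "1 + norm x \<le> R + (\<Sum>i\<in>UNIV. (2 + \<bar>c i\<bar> + \<bar>d i\<bar>) * R)"
        using R1 norm_le_l1_cart[of x] sum_mono[of UNIV "\<lambda>i. \<bar>x $ i\<bar>" "\<lambda>i. (2 + \<bar>c i\<bar> + \<bar>d i\<bar>) * R"] comp
        by fastforce
      also have "\<dots> = D * R"
        by (simp add: D_def distrib_right sum_distrib_right)
      finally have "(D * R) powr - N \<le> (1 + norm x) powr - N"
        using N by (intro powr_mono2') (auto simp: add_pos_nonneg)
      moreover have "(\<Prod>i\<in>UNIV. if i \<in> U then R ^ k i else e i ^ k i) \<le> (\<Prod>i\<in>UNIV. \<bar>x $ i\<bar> ^ k i)"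
        using R1 abs_TU[OF x] T_notU[OF x] e
        by (intro prod_mono) (auto intro!: power_mono simp: less_imp_le)
      ultimately show ?thesis
        unfolding v_def by (intro mult_mono) (auto intro!: prod_nonneg)
    qed
    have "(\<Prod>i\<in>UNIV. hi i - lo i) = (\<Prod>i\<in>UNIV. if i \<in> U then R else d i - c i)"
      by (intro prod.cong) (auto simp: hi_def lo_def)
    moreover have le: "lo i \<le> hi i" for i
      using R1 cd by (auto simp: hi_def lo_def less_imp_le)
    have "cbox (\<chi> i. lo i) (\<chi> i. hi i) \<noteq> {}"
      using le by (subst interval_ne_empty_cart) simp
    then have "measure lborel T = (\<Prod>i\<in>UNIV. hi i - lo i)"
      unfolding T_def by (simp add: content_cbox_cart)
    moreover have "emeasure lborel T = ennreal (measure lborel T)"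
      unfolding T_def by (intro emeasure_eq_ennreal_measure) (simp add: emeasure_lborel_cbox_eq)
    ultimately have vol: "emeasure lborel T = ennreal (\<Prod>i\<in>UNIV. if i \<in> U then R else d i - c i)"
      by simp
    have "v * (\<Prod>i\<in>UNIV. if i \<in> U then R else d i - c i) =
      (\<Prod>i\<in>UNIV. (if i \<in> U then 1 else e i ^ k i * (d i - c i)) *
        R powr (if i \<in> U then real (k i) + 1 else 0)) * (D powr - N * R powr - N)"
      unfolding v_def using D R1
      by (simp add: powr_mult mult_ac flip: prod.distrib)
        (auto intro!: prod.cong simp: powr_add powr_realpow)
    also have "\<dots> = C * ((\<Prod>i\<in>UNIV. R powr (if i \<in> U then real (k i) + 1 else 0)) * R powr - N)"
      by (simp add: C_def prod.distrib mult_ac)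
    also have "(\<Prod>i\<in>UNIV. R powr (if i \<in> U then real (k i) + 1 else 0)) =
        R powr (\<Sum>i\<in>UNIV. if i \<in> U then real (k i) + 1 else 0)"
      using R1 by (intro powr_sum[symmetric]) auto
    also have "(\<Sum>i\<in>UNIV. if i \<in> U then real (k i) + 1 else 0) = (\<Sum>i\<in>U. real (k i) + 1)"
      by (simp add: sum.If_cases)
    also have "R powr (\<Sum>i\<in>U. real (k i) + 1) * R powr - N = R powr ((\<Sum>i\<in>U. real (k i) + 1) - N)"
      by (simp flip: powr_add)
    finally have v_vol: "v * (\<Prod>i\<in>UNIV. if i \<in> U then R else d i - c i) =
      C * R powr ((\<Sum>i\<in>U. real (k i) + 1) - N)" .
    have v: "v \<ge> 0"
      unfolding v_def using R1 e by (intro mult_nonneg_nonneg prod_nonneg) (auto simp: less_imp_le)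
    have "ennreal (C * R powr ((\<Sum>i\<in>U. real (k i) + 1) - N)) = ennreal v * emeasure lborel T"
      unfolding vol v_vol[symmetric] using v by (simp add: ennreal_mult')
    also have "\<dots> = (\<integral>\<^sup>+x. ennreal v * indicator T x \<partial>lborel)"
      by (rule nn_integral_cmult_indicator[symmetric]) (simp add: T_def)
    also have "\<dots> \<le> (\<integral>\<^sup>+x. ennreal ((\<Prod>i\<in>UNIV. \<bar>x $ i\<bar> ^ k i) * (1 + norm x) powr - N) * indicator T x \<partial>lborel)"
      using v_le by (intro nn_integral_mono) (auto simp: indicator_def intro!: ennreal_leI)
    finally have "ennreal (C * R powr ((\<Sum>i\<in>U. real (k i) + 1) - N)) \<le>
      (\<integral>\<^sup>+x. ennreal ((\<Prod>i\<in>UNIV. \<bar>x $ i\<bar> ^ k i) * (1 + norm x) powr - N) * indicator T x \<partial>lborel)" .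
    moreover have "T \<in> sets borel"
      by (simp add: T_def)
    ultimately show ?thesis
      using mem abs_TU by (intro bexI[of _ T]) auto
  qed
  then show ?thesis
    using C R0 by blast
qed

text \<open>A single box already carries positive mass. With zero exponents this gives positive
  probability to the truncation event.\<close>

lemma nn_integral_monomial_pos:
  fixes A :: "'n::finite \<Rightarrow> real set" and k :: "'n \<Rightarrow> nat"
  assumes "\<And>i. i \<in> U \<Longrightarrow> \<exists>s M. (s = 1 \<or> s = - 1) \<and> (\<forall>t\<ge>M. s * t \<in> A i)"
    and "\<And>i. i \<notin> U \<Longrightarrow> \<exists>c d. c < d \<and> {c..d} \<subseteq> A i"
    and "N \<ge> 0"
  shows "(\<integral>\<^sup>+x. ennreal ((\<Prod>i\<in>UNIV. \<bar>x $ i\<bar> ^ k i) * (1 + norm x) powr - N) *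
    indicator {x. \<forall>i. x $ i \<in> A i} x \<partial>lborel) > 0"
proof -
  define h where "h = (\<lambda>x::real^'n. ennreal ((\<Prod>i\<in>UNIV. \<bar>x $ i\<bar> ^ k i) * (1 + norm x) powr - N))"
  define X where "X = {x::real^'n. \<forall>i. x $ i \<in> A i}"
  define p where "p = (\<Sum>i\<in>U. real (k i) + 1) - N"
  have "\<exists>C>0. \<exists>R0\<ge>1. \<forall>R\<ge>R0. \<exists>T\<in>sets borel. T \<subseteq> X \<and>
    (\<forall>x\<in>T. \<forall>i\<in>U. R \<le> \<bar>x $ i\<bar> \<and> \<bar>x $ i\<bar> \<le> 2 * R) \<and>
    ennreal (C * R powr p) \<le> (\<integral>\<^sup>+x. h x * indicator T x \<partial>lborel)"
    unfolding h_def X_def p_def by (rule nn_integral_monomial_box[OF assms])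
  then obtain C R T where "C > 0" "R \<ge> 1" and T: "T \<subseteq> X"
    and CT: "ennreal (C * R powr p) \<le> (\<integral>\<^sup>+x. h x * indicator T x \<partial>lborel)"
    by (metis order_refl)
  then have "0 < ennreal (C * R powr p)"
    by simp
  also note CT
  also have "(\<integral>\<^sup>+x. h x * indicator T x \<partial>lborel) \<le> (\<integral>\<^sup>+x. h x * indicator X x \<partial>lborel)"
    using T by (intro nn_integral_mono mult_left_mono) (auto simp: indicator_def)
  finally show ?thesis
    by (simp add: h_def X_def)
qed

lemma nn_integral_monomial_infinite:
  fixes A :: "'n::finite \<Rightarrow> real set" and k :: "'n \<Rightarrow> nat"
  assumes A: "\<And>i. A i \<in> sets borel"
    and ray: "\<And>i. i \<in> U \<Longrightarrow> \<exists>s M. (s = 1 \<or> s = - 1) \<and> (\<forall>t\<ge>M. s * t \<in> A i)"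
    and interval: "\<And>i. i \<notin> U \<Longrightarrow> \<exists>c d. c < d \<and> {c..d} \<subseteq> A i"
    and N: "N \<ge> 0" "N \<le> (\<Sum>i\<in>U. real (k i) + 1)" and U: "U \<noteq> {}"
  shows "(\<integral>\<^sup>+x. ennreal ((\<Prod>i\<in>UNIV. \<bar>x $ i\<bar> ^ k i) * (1 + norm x) powr - N) *
    indicator {x. \<forall>i. x $ i \<in> A i} x \<partial>lborel) = \<infinity>"
proof -
  define h where "h = (\<lambda>x::real^'n. ennreal ((\<Prod>i\<in>UNIV. \<bar>x $ i\<bar> ^ k i) * (1 + norm x) powr - N))"
  define X where "X = {x::real^'n. \<forall>i. x $ i \<in> A i}"
  have [measurable]: "h \<in> borel_measurable borel"
    unfolding h_def by measurable
  note A[measurable]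
  have [measurable]: "X \<in> sets borel"
    unfolding X_def by measurable
  define p where "p = (\<Sum>i\<in>U. real (k i) + 1) - N"
  have "\<exists>C>0. \<exists>R0\<ge>1. \<forall>R\<ge>R0. \<exists>T\<in>sets borel. T \<subseteq> X \<and>
    (\<forall>x\<in>T. \<forall>i\<in>U. R \<le> \<bar>x $ i\<bar> \<and> \<bar>x $ i\<bar> \<le> 2 * R) \<and>
    ennreal (C * R powr p) \<le> (\<integral>\<^sup>+x. h x * indicator T x \<partial>lborel)"
    unfolding h_def X_def p_def by (rule nn_integral_monomial_box[OF ray interval N(1)])
  then obtain C R0 where C: "C > 0" and R0: "R0 \<ge> (1::real)"
    and ex: "\<forall>R\<ge>R0. \<exists>T\<in>sets borel. T \<subseteq> X \<and> (\<forall>x\<in>T. \<forall>i\<in>U. R \<le> \<bar>x $ i\<bar> \<and> \<bar>x $ i\<bar> \<le> 2 * R) \<and>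
      ennreal (C * R powr p) \<le> (\<integral>\<^sup>+x. h x * indicator T x \<partial>lborel)"
    by blast
  \<comment> \<open>The ratio 3 exceeds the factor 2 between the ends of a box side, so the ranges
    [r n, 2 r n] are pairwise disjoint.\<close>
  define r where "r n = R0 * 3 ^ n" for n :: nat
  have r: "r n \<ge> R0" "r n \<ge> 1" for n
    using R0 mult_mono[of R0 R0 1 "3 ^ n"] by (auto simp: r_def intro: order_trans)
  define Q where "Q n T \<longleftrightarrow> T \<in> sets borel \<and> T \<subseteq> X \<and>
    (\<forall>x\<in>T. \<forall>i\<in>U. r n \<le> \<bar>x $ i\<bar> \<and> \<bar>x $ i\<bar> \<le> 2 * r n) \<and>
    ennreal (C * r n powr p) \<le> (\<integral>\<^sup>+x. h x * indicator T x \<partial>lborel)" for n T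
  have "\<forall>n. \<exists>T. Q n T"
    using ex r(1) unfolding Q_def Bex_def by simp
  then obtain T where "\<And>n. Q n (T n)"
    by metis
  then have T_sets: "\<And>n. T n \<in> sets borel" and T_sub: "\<And>n. T n \<subseteq> X"
    and T_norm: "\<And>n x i. x \<in> T n \<Longrightarrow> i \<in> U \<Longrightarrow> r n \<le> \<bar>x $ i\<bar> \<and> \<bar>x $ i\<bar> \<le> 2 * r n"
    and T_int: "\<And>n. ennreal (C * r n powr p) \<le> (\<integral>\<^sup>+x. h x * indicator (T n) x \<partial>lborel)"
    by (simp_all add: Q_def)
  define \<mu> where "\<mu> = density lborel h"
  have \<mu>: "emeasure \<mu> S = (\<integral>\<^sup>+x. h x * indicator S x \<partial>lborel)" if "S \<in> sets borel" for S
    unfolding \<mu>_def using that by (intro emeasure_density) auto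
  have T_ge: "ennreal C \<le> emeasure \<mu> (T n)" for n
  proof -
    \<comment> \<open>Here the non-strict bound on \<open>N\<close> enters: \<open>p\<close> is
      nonnegative, and even for p = 0 each box keeps mass at least \<open>C\<close>.\<close>
    have "1 \<le> r n powr p"
      using r N by (intro ge_one_powr_ge_zero) (auto simp: p_def)
    then have "ennreal C \<le> ennreal (C * r n powr p)"
      using C by (intro ennreal_leI) auto
    then show ?thesis
      using T_int T_sets by (auto simp: \<mu> intro: order_trans)
  qed
  have r_step: "2 * r m < r n" if "m < n" for m n
  proof -
    have "(3::real) ^ Suc m \<le> 3 ^ n"
      using that by (intro power_increasing) auto
    then have "R0 * (3 * 3 ^ m) \<le> R0 * 3 ^ n"
      using R0 by (intro mult_left_mono) auto
    moreover have "0 < R0 * 3 ^ m"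
      using R0 by simp
    ultimately show ?thesis
      by (simp add: r_def)
  qed
  \<comment> \<open>One unbounded coordinate separates all the boxes.\<close>
  obtain i0 where i0: "i0 \<in> U"
    using U by blast
  have "T m \<inter> T n = {}" if "m < n" for m n
    using T_norm[OF _ i0] r_step[OF that] by (meson disjoint_iff le_less_trans not_le order_trans)
  then have disj: "disjoint_family T"
    unfolding disjoint_family_on_def by (metis Int_commute linorder_neqE_nat)
  have "of_nat m * ennreal C \<le> emeasure \<mu> X" for m
  proof -
    have "of_nat m * ennreal C = (\<Sum>n<m. ennreal C)"
      by simp
    also have "\<dots> \<le> (\<Sum>n<m. emeasure \<mu> (T n))"
      by (intro sum_mono T_ge)
    also have "\<dots> = emeasure \<mu> (\<Union>n<m. T n)"
      using T_sets disj by (intro sum_emeasure) (auto simp: \<mu>_def disjoint_family_on_def)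
    also have "\<dots> \<le> emeasure \<mu> X"
      using T_sub by (intro emeasure_mono) (auto simp: \<mu>_def)
    finally show ?thesis .
  qed
  moreover have "\<exists>m. \<not> of_nat m * ennreal C \<le> ennreal y" if "y \<ge> 0" for y
  proof -
    obtain m :: nat where "y / C < m"
      using reals_Archimedean2[of "y / C"] by blast
    then have "y < m * C"
      using C by (simp add: field_simps)
    moreover have "of_nat m * ennreal C = ennreal (m * C)"
      using C by (simp add: ennreal_of_nat_eq_real_of_nat ennreal_mult)
    ultimately have "\<not> of_nat m * ennreal C \<le> ennreal y"
      using that by (simp add: ennreal_less_iff not_le)
    then show ?thesis ..
  qed
  ultimately have "\<not> (\<exists>y\<ge>0. emeasure \<mu> X = ennreal y)"
    by metis
  then have "emeasure \<mu> X = \<infinity>"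
    using ennreal_cases[of "emeasure \<mu> X"] by (metis infinity_ennreal_def)
  then show ?thesis
    by (simp add: \<mu> h_def X_def)
qed

section \<open>Reduction of the moment to a Lebesgue integral\<close>

lemma mvt_density_measurable [measurable]: "mvt_density \<xi> \<Omega> \<nu> \<in> borel_measurable borel"
proof -
  have [measurable]: "(\<lambda>x. matrix_inv \<Omega> *v x) \<in> borel_measurable borel"
    by (intro borel_measurable_continuous_onI linear_continuous_on matrix_vector_mul_bounded_linear)
  show ?thesis
    unfolding mvt_density_def by measurable
qed

lemma sets_mvt [measurable_cong, simp]: "sets (mvt \<xi> \<Omega> \<nu>) = sets borel"
  by (simp add: mvt_def)

text \<open>The constants are chosen before \<open>g\<close>, so a single pair serves both the
  moment and the probability of the truncation event. The density is replaced by its tail weight and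
  the law of \<open>Y\<close> is pulled back to the joint space.\<close>

lemma SUT_nn_integral_bounds:
  fixes M :: "'w measure" and Y :: "'w \<Rightarrow> real^'p" and \<Lambda> :: "real^'q^'p"
  assumes \<nu>: "\<nu> > 0" and \<Sigma>: "pos_def \<Sigma>" and \<Psi>: "pos_def \<Psi>"
    and M: "prob_space M" and Y [measurable]: "Y \<in> borel_measurable M"
    and law: "distr M borel Y = SUT \<mu> \<Sigma> \<Lambda> \<tau> \<nu> \<Psi>"
  defines "J \<equiv> \<lambda>g. \<integral>\<^sup>+x. ennreal ((1 + norm x) powr - (\<nu> + real CARD('q + 'p))) *
    (g (\<chi> i. x $ Inr i) * indicator {x::real^('q + 'p). \<forall>j. x $ Inl j > 0} x) \<partial>lborel"
  shows "\<exists>c1>0. \<exists>c2>0. \<forall>g\<in>borel_measurable borel.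
    ennreal c1 * J g \<le> (\<integral>\<^sup>+\<omega>. g (Y \<omega>) \<partial>M) \<and> (\<integral>\<^sup>+\<omega>. g (Y \<omega>) \<partial>M) \<le> ennreal c2 * J g"
proof -
  interpret prob_space M
    by (rule M)
  define \<Omega> where "\<Omega> = sut_scale \<Sigma> \<Lambda> \<Psi>"
  define P where "P = mvt (vec_append \<tau> \<mu>) \<Omega> \<nu>"
  define A where "A = {x::real^('q + 'p). \<forall>j. x $ Inl j > 0}"
  define f where "f = mvt_density (vec_append \<tau> \<mu>) \<Omega> \<nu>"
  define w where "w x = (1 + norm x) powr - (\<nu> + real CARD('q + 'p))" for x :: "real^('q + 'p)"
  have P_sets [measurable_cong]: "sets P = sets borel"
    by (simp add: P_def)
  have [measurable]: "A \<in> sets borel"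
    unfolding A_def by measurable
  have [measurable]: "(\<lambda>x::real^('q + 'p). \<chi> i. x $ Inr i) \<in> borel_measurable borel"
    by (intro borel_measurable_continuous_onI continuous_intros)
  have [measurable]: "f \<in> borel_measurable borel" "w \<in> borel_measurable borel"
    unfolding f_def w_def by measurable
  have law_eq: "(\<integral>\<^sup>+\<omega>. g (Y \<omega>) \<partial>M) =
    (\<integral>\<^sup>+x. ennreal (f x) * (g (\<chi> i. x $ Inr i) * indicator A x) \<partial>lborel) / emeasure P A"
    if [measurable]: "g \<in> borel_measurable borel" for g
  proof -
    have "(\<integral>\<^sup>+\<omega>. g (Y \<omega>) \<partial>M) = (\<integral>\<^sup>+y. g y \<partial>distr M borel Y)"
      by (intro nn_integral_distr[symmetric]) auto
    also have "\<dots> = (\<integral>\<^sup>+x. g (\<chi> i. x $ Inr i) \<partial>uniform_measure P A)"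
      unfolding law SUT_def P_def A_def \<Omega>_def by (intro nn_integral_distr) auto
    also have "\<dots> = (\<integral>\<^sup>+x. g (\<chi> i. x $ Inr i) * indicator A x \<partial>P) / emeasure P A"
      by (intro nn_integral_uniform_measure) auto
    also have "(\<integral>\<^sup>+x. g (\<chi> i. x $ Inr i) * indicator A x \<partial>P) =
      (\<integral>\<^sup>+x. ennreal (f x) * (g (\<chi> i. x $ Inr i) * indicator A x) \<partial>lborel)"
      unfolding P_def mvt_def f_def by (intro nn_integral_density) auto
    finally show ?thesis .
  qed
  have "emeasure P A = (\<integral>\<^sup>+x. ennreal (f x) * indicator A x \<partial>lborel)"
    unfolding P_def mvt_def f_def by (intro emeasure_density) auto
  \<comment> \<open>The Student density is never integrated. \<open>Y\<close> has total mass one,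
    while in \<open>ennreal\<close> both 0/0 and the quotient of two infinities are 0; hence the
    mass of \<open>A\<close> is positive and finite.\<close>
  then have one: "1 = emeasure P A / emeasure P A"
    using law_eq[of "\<lambda>_. 1"] by (simp add: emeasure_space_1)
  then have "emeasure P A \<noteq> 0" "emeasure P A \<noteq> \<infinity>"
    by (auto simp: ennreal_divide_self)
  then obtain z where z: "z > 0" "emeasure P A = ennreal z"
    by (cases "emeasure P A" rule: ennreal_cases) (auto simp: less_le)
  obtain c1 c2 where c: "c1 > 0" "c2 > 0" and c1: "\<And>x. c1 * w x \<le> f x" and c2: "\<And>x. f x \<le> c2 * w x"
    unfolding w_def f_def \<Omega>_def
    using mvt_density_bounds[OF pos_def_sut_scale[OF \<Sigma> \<Psi>] \<nu>] by metis
  have J: "J g = (\<integral>\<^sup>+x. ennreal (w x) * (g (\<chi> i. x $ Inr i) * indicator A x) \<partial>lborel)" for g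
    by (simp add: J_def w_def A_def)
  have scale: "(\<integral>\<^sup>+x. ennreal (C * w x) * (g (\<chi> i. x $ Inr i) * indicator A x) \<partial>lborel) / ennreal z =
    ennreal (C / z) * J g" if "C > 0" and [measurable]: "g \<in> borel_measurable borel" for C g
  proof -
    have "(\<integral>\<^sup>+x. ennreal (C * w x) * (g (\<chi> i. x $ Inr i) * indicator A x) \<partial>lborel) =
      (\<integral>\<^sup>+x. ennreal C * (ennreal (w x) * (g (\<chi> i. x $ Inr i) * indicator A x)) \<partial>lborel)"
      using that by (simp add: ennreal_mult' mult.assoc)
    also have "\<dots> = ennreal C * J g"
      unfolding J by (intro nn_integral_cmult) measurable
    also have "ennreal C * J g / ennreal z = ennreal C / ennreal z * J g"
      by (simp add: ennreal_times_divide mult.commute)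
    also have "ennreal C / ennreal z = ennreal (C / z)"
      using that z by (intro divide_ennreal) auto
    finally show ?thesis .
  qed
  have "ennreal (c1 / z) * J g \<le> (\<integral>\<^sup>+\<omega>. g (Y \<omega>) \<partial>M) \<and> (\<integral>\<^sup>+\<omega>. g (Y \<omega>) \<partial>M) \<le> ennreal (c2 / z) * J g"
    if g: "g \<in> borel_measurable borel" for g
    unfolding law_eq[OF g] z scale[OF c(1) g, symmetric] scale[OF c(2) g, symmetric]
    by (intro conjI divide_right_mono_ennreal nn_integral_mono mult_right_mono ennreal_leI c1 c2) auto
  moreover have "c1 / z > 0" "c2 / z > 0"
    using c z by auto
  ultimately show ?thesis
    by blast
qed

text \<open>The sign \<open>s\<close> records the direction. A finite upper limit forces the lower
  one to be minus infinity and the ray points down; an infinite upper limit admits a ray pointing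
  up.\<close>

lemma ereal_interval_ray:
  fixes a b :: ereal
  assumes "a < b" "\<bar>a\<bar> = \<infinity> \<or> \<bar>b\<bar> = \<infinity>"
  shows "\<exists>s M. (s = 1 \<or> s = - 1) \<and> (\<forall>t\<ge>M. a \<le> ereal (s * t) \<and> ereal (s * t) \<le> b)"
proof (cases b)
  case (real r)
  then show ?thesis
    using assms by (intro exI[of _ "-1"] exI[of _ "- r"]) auto
next
  case PInf
  show ?thesis
  proof (cases a)
    case (real r)
    then show ?thesis
      using PInf by (intro exI[of _ 1] exI[of _ r]) auto
  qed (use assms PInf in auto)
qed (use assms in auto)

lemma ereal_interval_real:
  fixes a b :: ereal
  assumes "a < b" "\<bar>a\<bar> \<noteq> \<infinity>" "\<bar>b\<bar> \<noteq> \<infinity>"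
  shows "\<exists>c d. c < d \<and> {t. a \<le> ereal t \<and> ereal t \<le> b} = {c..d}"
proof -
  obtain c d where "a = ereal c" "b = ereal d"
    using assms by (cases a; cases b) auto
  then show ?thesis
    using assms by (intro exI[of _ c] exI[of _ d]) auto
qed

theorem proposition2:
  fixes M :: "'w measure" and Y :: "'w \<Rightarrow> real^'p"
    and \<mu> :: "real^'p" and \<Sigma> :: "real^'p^'p" and \<Lambda> :: "real^'q^'p"
    and \<tau> :: "real^'q" and \<nu> :: real and \<Psi> :: "real^'q^'q"
    and a b :: "ereal^'p" and k :: "nat^'p" and I1 I2 :: "'p set"
  assumes "\<nu> > 0" and "pos_def \<Sigma>" and "correlation_matrix \<Psi>"
    and "prob_space M" and "Y \<in> borel_measurable M"
    and "distr M borel Y = SUT \<mu> \<Sigma> \<Lambda> \<tau> \<nu> \<Psi>"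
    and "\<And>i. a $ i < b $ i"
  defines "I1 \<equiv> {i. \<bar>a $ i\<bar> \<noteq> \<infinity> \<and> \<bar>b $ i\<bar> \<noteq> \<infinity>}"
    and "I2 \<equiv> {i. \<bar>a $ i\<bar> = \<infinity> \<or> \<bar>b $ i\<bar> = \<infinity>}"
  shows "integrable
      (uniform_measure M {\<omega> \<in> space M. \<forall>i. a $ i \<le> ereal (Y \<omega> $ i) \<and> ereal (Y \<omega> $ i) \<le> b $ i})
      (\<lambda>\<omega>. \<Prod>i\<in>UNIV. (Y \<omega> $ i) ^ (k $ i))
    \<longleftrightarrow> real (\<Sum>i\<in>I2. k $ i) < \<nu> + real (card I1)"
proof -
  interpret prob_space M
    by (rule assms)
  note [measurable] = assms(5)
  have [measurable]: "(\<lambda>\<omega>. Y \<omega> $ i) \<in> borel_measurable M" for i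
    by (rule measurable_compose[OF assms(5)]) measurable
  define N where "N = \<nu> + real CARD('q + 'p)"
  define R where "R = {y::real^'p. \<forall>i. a $ i \<le> ereal (y $ i) \<and> ereal (y $ i) \<le> b $ i}"
  define E where "E = {\<omega> \<in> space M. Y \<omega> \<in> R}"
  have [measurable]: "R \<in> sets borel"
    unfolding R_def by measurable
  have [measurable]: "E \<in> sets M"
    unfolding E_def by measurable
  \<comment> \<open>On the joint space both conditionings become one product set: positive
    half-lines for the \<open>Inl\<close> coordinates, truncation intervals for the
    \<open>Inr\<close> ones. Accordingly \<open>kk\<close> extends the exponents by zero.\<close>
  define A :: "'q + 'p \<Rightarrow> real set" where
    "A = case_sum (\<lambda>_. {0<..}) (\<lambda>i. {t. a $ i \<le> ereal t \<and> ereal t \<le> b $ i})"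
  define U :: "('q + 'p) set" where "U = range Inl \<union> Inr ` I2"
  define kk :: "(nat^'p) \<Rightarrow> 'q + 'p \<Rightarrow> nat" where "kk l = case_sum (\<lambda>_. 0) (\<lambda>i. l $ i)" for l
  \<comment> \<open>The exponent vector stays variable: \<open>l = k\<close> gives the truncated
    absolute moment, \<open>l = 0\<close> the indicator of the truncation.\<close>
  define h where "h l y = ennreal (\<Prod>i\<in>UNIV. \<bar>y $ i\<bar> ^ (l $ i)) * indicator R y" for l :: "nat^'p" and y
  define J where "J l = (\<integral>\<^sup>+x. ennreal ((\<Prod>i\<in>UNIV. \<bar>x $ i\<bar> ^ kk l i) * (1 + norm x) powr - N) *
    indicator {x. \<forall>i. x $ i \<in> A i} x \<partial>lborel)" for l
  have [measurable]: "h l \<in> borel_measurable borel" for l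
    unfolding h_def by measurable
  have A_borel: "A i \<in> sets borel" for i
    by (cases i) (auto simp: A_def)
  have J_eq: "J l = (\<integral>\<^sup>+x. ennreal ((1 + norm x) powr - N) *
    (h l (\<chi> i. x $ Inr i) * indicator {x::real^('q + 'p). \<forall>j. x $ Inl j > 0} x) \<partial>lborel)" for l
    unfolding J_def
  proof (intro nn_integral_cong)
    fix x :: "real^('q + 'p)"
    have "(\<forall>i. x $ i \<in> A i) \<longleftrightarrow> (\<chi> i. x $ Inr i) \<in> R \<and> (\<forall>j. x $ Inl j > 0)"
      by (auto simp: A_def R_def split_sum_all)
    then show "ennreal ((\<Prod>i\<in>UNIV. \<bar>x $ i\<bar> ^ kk l i) * (1 + norm x) powr - N) *
        indicator {x. \<forall>i. x $ i \<in> A i} x = ennreal ((1 + norm x) powr - N) *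
        (h l (\<chi> i. x $ Inr i) * indicator {x. \<forall>j. x $ Inl j > 0} x)"
      by (auto simp: h_def kk_def prod_UNIV_Plus indicator_def ennreal_mult' mult.commute prod_nonneg)
  qed
  have \<Psi>: "pos_def \<Psi>"
    using assms(3) by (simp add: correlation_matrix_def)
  obtain c1 c2 where c: "c1 > 0" "c2 > 0"
    and c12: "\<And>l. ennreal c1 * J l \<le> (\<integral>\<^sup>+\<omega>. h l (Y \<omega>) \<partial>M) \<and> (\<integral>\<^sup>+\<omega>. h l (Y \<omega>) \<partial>M) \<le> ennreal c2 * J l"
  proof -
    have "h l \<in> borel_measurable borel" for l
      by measurable
    then show thesis
      using SUT_nn_integral_bounds[OF assms(1,2) \<Psi> assms(4,5,6)] that
      unfolding J_eq N_def by blast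
  qed
  then have c1: "\<And>l. ennreal c1 * J l \<le> (\<integral>\<^sup>+\<omega>. h l (Y \<omega>) \<partial>M)"
    and c2: "\<And>l. (\<integral>\<^sup>+\<omega>. h l (Y \<omega>) \<partial>M) \<le> ennreal c2 * J l"
    by simp_all
  have ray: "\<exists>s m. (s = 1 \<or> s = - 1) \<and> (\<forall>t\<ge>m. s * t \<in> A i)" if "i \<in> U" for i
  proof (cases i)
    case (Inl j)
    then show ?thesis
      by (intro exI[of _ 1]) (auto simp: A_def)
  next
    case (Inr j)
    then show ?thesis
      using that ereal_interval_ray[OF assms(7)[of j]] by (auto simp: A_def U_def I2_def)
  qed
  have interval: "\<exists>c d. c < d \<and> A i = {c..d}" if "i \<notin> U" for i
  proof (cases i)
    case (Inl j)
    then show ?thesis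
      using that by (simp add: U_def)
  next
    case (Inr j)
    then have "\<bar>a $ j\<bar> \<noteq> \<infinity>" "\<bar>b $ j\<bar> \<noteq> \<infinity>"
      using that by (auto simp: U_def I2_def)
    then show ?thesis
      using ereal_interval_real[OF assms(7)[of j]] by (simp add: A_def Inr)
  qed
  have interval': "\<exists>c d. c < d \<and> {c..d} \<subseteq> A i" and bdd: "bounded (A i)" if i: "i \<notin> U" for i
  proof -
    obtain c d where cd: "c < d" "A i = {c..d}"
      using interval[OF i] by blast
    then show "\<exists>c d. c < d \<and> {c..d} \<subseteq> A i"
      by blast
    show "bounded (A i)"
      by (simp add: cd)
  qed
  have N: "N \<ge> 0"
    using assms(1) by (simp add: N_def)
  have J_pos: "J l > 0" for l
    unfolding J_def by (rule nn_integral_monomial_pos[OF ray interval' N])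
  have "J k < \<infinity> \<longleftrightarrow> (\<Sum>i\<in>U. real (kk k i) + 1) < N"
  proof
    assume "(\<Sum>i\<in>U. real (kk k i) + 1) < N"
    then show "J k < \<infinity>"
      unfolding J_def by (intro nn_integral_monomial_finite A_borel bdd)
  next
    assume finite: "J k < \<infinity>"
    \<comment> \<open>The type \<open>'q\<close> is inhabited, so unbounded coordinates exist even
      when every truncation limit is finite.\<close>
    have "U \<noteq> {}"
      by (simp add: U_def)
    show "(\<Sum>i\<in>U. real (kk k i) + 1) < N"
    proof (rule ccontr)
      assume "\<not> ?thesis"
      then have "N \<le> (\<Sum>i\<in>U. real (kk k i) + 1)"
        by simp
      from nn_integral_monomial_infinite[OF A_borel ray interval' N this \<open>U \<noteq> {}\<close>]
      have "J k = \<infinity>"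
        by (simp add: J_def)
      with finite show False
        by simp
    qed
  qed
  \<comment> \<open>Each \<open>Inl\<close> coordinate contributes 0 + 1; the resulting
    \<open>CARD('q)\<close> and the \<open>card I2\<close> cancel against the same terms in
    \<open>N\<close>.\<close>
  also have "(\<Sum>i\<in>U. real (kk k i) + 1) = real CARD('q) + real (\<Sum>i\<in>I2. k $ i) + real (card I2)"
    unfolding U_def by (subst sum.union_disjoint) (auto simp: sum.reindex kk_def sum.distrib card_image)
  also have "N = \<nu> + real CARD('q) + real (card I1) + real (card I2)"
  proof -
    have "CARD('p) = card (I1 \<union> I2)"
      by (rule arg_cong[where f = card]) (auto simp: I1_def I2_def)
    also have "\<dots> = card I1 + card I2"
      by (rule card_Un_disjoint) (auto simp: I1_def I2_def)
    finally show ?thesis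
      by (simp add: N_def)
  qed
  finally have J_iff: "J k < \<infinity> \<longleftrightarrow> real (\<Sum>i\<in>I2. k $ i) < \<nu> + real (card I1)"
    by simp
  have "emeasure M E = (\<integral>\<^sup>+\<omega>. h 0 (Y \<omega>) \<partial>M)"
  proof -
    have "emeasure M E = (\<integral>\<^sup>+\<omega>. indicator E \<omega> \<partial>M)"
      by simp
    also have "\<dots> = (\<integral>\<^sup>+\<omega>. h 0 (Y \<omega>) \<partial>M)"
      by (intro nn_integral_cong) (auto simp: h_def E_def indicator_def)
    finally show ?thesis .
  qed
  moreover have "0 < ennreal c1 * J 0"
    using c J_pos by (simp add: ennreal_zero_less_mult_iff)
  \<comment> \<open>With this and finiteness of the measure, normalising by the probability of
    \<open>E\<close> does not affect whether the integral is finite.\<close>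
  ultimately have E_pos: "emeasure M E > 0"
    using c1[of 0] by simp
  have [simp]: "(\<lambda>\<omega>. \<Prod>i\<in>UNIV. (Y \<omega> $ i) ^ (k $ i)) \<in> borel_measurable (uniform_measure M E)"
    by measurable
  have "integrable (uniform_measure M E) (\<lambda>\<omega>. \<Prod>i\<in>UNIV. (Y \<omega> $ i) ^ (k $ i)) \<longleftrightarrow>
    (\<integral>\<^sup>+\<omega>. ennreal (\<Prod>i\<in>UNIV. \<bar>Y \<omega> $ i\<bar> ^ (k $ i)) \<partial>uniform_measure M E) < \<infinity>"
    unfolding integrable_iff_bounded by (simp add: abs_prod power_abs)
  also have "(\<integral>\<^sup>+\<omega>. ennreal (\<Prod>i\<in>UNIV. \<bar>Y \<omega> $ i\<bar> ^ (k $ i)) \<partial>uniform_measure M E) =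
    (\<integral>\<^sup>+\<omega>. ennreal (\<Prod>i\<in>UNIV. \<bar>Y \<omega> $ i\<bar> ^ (k $ i)) * indicator E \<omega> \<partial>M) / emeasure M E"
    by (rule nn_integral_uniform_measure) auto
  also have "(\<integral>\<^sup>+\<omega>. ennreal (\<Prod>i\<in>UNIV. \<bar>Y \<omega> $ i\<bar> ^ (k $ i)) * indicator E \<omega> \<partial>M) = (\<integral>\<^sup>+\<omega>. h k (Y \<omega>) \<partial>M)"
    by (intro nn_integral_cong) (auto simp: h_def E_def indicator_def)
  also have "(\<integral>\<^sup>+\<omega>. h k (Y \<omega>) \<partial>M) / emeasure M E < \<infinity> \<longleftrightarrow> (\<integral>\<^sup>+\<omega>. h k (Y \<omega>) \<partial>M) < \<infinity>"
    using E_pos emeasure_finite[of E] by (simp add: ennreal_divide_eq_top_iff less_top[symmetric] less_le)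
  also have "\<dots> \<longleftrightarrow> J k < \<infinity>"
  proof
    assume "(\<integral>\<^sup>+\<omega>. h k (Y \<omega>) \<partial>M) < \<infinity>"
    then have "ennreal c1 * J k < \<infinity>"
      using c1 by (rule le_less_trans[rotated])
    then show "J k < \<infinity>"
      using c by (auto simp: ennreal_mult_less_top)
  next
    assume "J k < \<infinity>"
    then have "ennreal c2 * J k < \<infinity>"
      by (simp add: ennreal_mult_less_top)
    with c2 show "(\<integral>\<^sup>+\<omega>. h k (Y \<omega>) \<partial>M) < \<infinity>"
      by (rule le_less_trans)
  qed
  also note J_iff
  finally show ?thesis
    unfolding E_def R_def mem_Collect_eq .
qed

end
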